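(* Let $\alpha_0>0$, $\varepsilon>0$, $0<T<\infty$, and let $\mu_0\in\mathcal M_{\alpha_0}$ be a Borel measure on $\mathbb R^D$ of total mass $1$. Let $0\le \alpha<\min\{\alpha_0,\varepsilon\}$. Then there exists a path $t\mapsto \mu_t^\varepsilon\in\mathcal M_\alpha$, $t\in[0,T]$, with $\mu_0^\varepsilon=\mu_0$, such that: (i) $(\mu_t^\varepsilon)_{t\in[0,T]}$ satisfies the deficient Hamiltonian ODE $$\partial_t\mu_t^\varepsilon+\nabla\cdot\big(J\nabla_W\mathcal H(\mu_t^\varepsilon)\,\mu_t^\varepsilon\big)=-\varepsilon\,|J\nabla_W\mathcal H(\mu_t^\varepsilon)|\,\mu_t^\varepsilon$$ in the sense of distributions on $(0,T)\times\mathbb R^D$; (ii) $t\mapsto\mu_t^\varepsilon\in\mathcal M_\alpha$ is narrowly continuous, and $M_\alpha(\mu_t^\varepsilon)$ is monotonically nonincreasing in $t$. In particular $M_0(\mu_t^\varepsilon)\le 1$ for $t\in[0,T]$.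
   Context: Let $D=2d$ and write points of $\mathbb R^D$ as $x=(p,q)$ with $p,q\in\mathbb R^d$. For a Borel measure $\mu$ on $\mathbb R^D$ and $\alpha\ge0$, $M_\alpha(\mu)=\int e^{\alpha|x|}\,d\mu(x)$ (so $M_0(\mu)$ is the total mass), and $\mathcal M_\alpha$ is the set of Borel measures with $M_\alpha(\mu)<\infty$. $W\in C_c^2(\mathbb R^d)$ is even, and $\Phi\in C^2(\mathbb R^d)$ satisfies $|\Phi(q)|\le B_1|q|^{b_2}$ for finite constants $B_1,b_2$. For a finite Borel measure $\mu$ on $\mathbb R^D$, $(W*\mu)(q)=\int W(q-q')\,d\mu(p',q')$. The Hamiltonian is $$\mathcal H(\mu)=\tfrac12\int|p|^2d\mu(x)+\tfrac12\int(W*\mu)(q)\,d\mu(x)+\int\Phi(q)\,d\mu(x),$$ and one defines $\nabla_W\mathcal H(\mu)(p,q)=(p,\nabla(W*\mu+\Phi)(q))$ and $J(p,q)=(-q,p)$, so that $J\nabla_W\mathcal H(\mu)(p,q)=(-\nabla(W*\mu+\Phi)(q),\,p)$. A family $(\mu_t)$ satisfies $\partial_t\mu_t+\nabla\cdot(v_t\mu_t)=-\varepsilon|v_t|\mu_t$ in the sense of distributions if $\int_0^T\!\int(\partial_t\varphi+\langle v_t,\nabla\varphi\rangle)\,d\mu_t\,dt=-\int_0^T\!\int\varepsilon|v_t|\varphi\,... d\mu_t\,dt$, i.e. with right-hand side $\int_0^T\!\int \varepsilon|v_t|\varphi\,d\mu_t\,dt$, for all $\varphi\in C_c^\infty((0,T)\times\mathbb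 R^D)$ (sign convention: the identity obtained by multiplying the equation by $\varphi$ and integrating by parts formally, $-\int_0^T\!\int(\partial_t\varphi+\langle v_t,\nabla\varphi\rangle)d\mu_tdt=-\int_0^T\!\int\varepsilon|v_t|\varphi\,d\mu_tdt$). Narrow continuity means $t\mapsto\int\varphi\,d\mu_t$ is continuous for every bounded continuous $\varphi$ on $\mathbb R^D$. *)

theory Defs
  imports "HOL-Analysis.Analysis"
begin

primrec Ck :: "nat \<Rightarrow> ('a::euclidean_space \<Rightarrow> real) \<Rightarrow> bool" where
  "Ck 0 f \<longleftrightarrow> continuous_on UNIV f"
| "Ck (Suc k) f \<longleftrightarrow>
     f differentiable_on UNIV \<and> (\<forall>i\<in>Basis. Ck k (\<lambda>x. frechet_derivative f (at x) i))"

definition supp :: "('a::topological_space \<Rightarrow> real) \<Rightarrow> 'a set" where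
  "supp f = closure {x. f x \<noteq> 0}"

text \<open>The unique \<open>D\<close> with \<open>GDERIV f x :> D\<close> wherever \<open>f\<close> is differentiable.\<close>

definition grad :: "('a::euclidean_space \<Rightarrow> real) \<Rightarrow> 'a \<Rightarrow> 'a" where
  "grad f x = (\<Sum>i\<in>Basis. frechet_derivative f (at x) i *\<^sub>R i)"

definition test_functions :: "('a::euclidean_space) set \<Rightarrow> ('a \<Rightarrow> real) set" where
  "test_functions U = {\<phi>. (\<forall>k. Ck k \<phi>) \<and> compact (supp \<phi>) \<and> supp \<phi> \<subseteq> U}"

definition exp_moment :: "real \<Rightarrow> ('a::euclidean_space) measure \<Rightarrow> ennreal" where
  "exp_moment \<alpha> \<mu> = (\<integral>\<^sup>+ x. ennreal (exp (\<alpha> * norm x)) \<partial>\<mu>)"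

definition exp_moment_measures :: "real \<Rightarrow> ('a::euclidean_space) measure set" where
  "exp_moment_measures \<alpha> = {\<mu>. sets \<mu> = sets borel \<and> exp_moment \<alpha> \<mu> < \<infinity>}"

text \<open>Phase space \<open>\<real>\<^sup>2\<^sup>d\<close> is \<open>(real ^ 'd) \<times> (real ^ 'd)\<close>, with points \<open>(p, q)\<close>; the product norm
  is the Euclidean one.\<close>

definition convol :: "(real ^ 'd \<Rightarrow> real) \<Rightarrow> ((real ^ 'd) \<times> (real ^ 'd)) measure \<Rightarrow> real ^ 'd \<Rightarrow> real" where
  "convol W \<mu> q = (\<integral>x'. W (q - snd x') \<partial>\<mu>)"

definition grad_Ham ::
  "(real ^ 'd \<Rightarrow> real) \<Rightarrow> (real ^ 'd \<Rightarrow> real) \<Rightarrow> ((real ^ 'd) \<times> (real ^ 'd)) measure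
    \<Rightarrow> (real ^ 'd) \<times> (real ^ 'd) \<Rightarrow> (real ^ 'd) \<times> (real ^ 'd)" where
  "grad_Ham W \<Phi> \<mu> x = (fst x, grad (\<lambda>q. convol W \<mu> q + \<Phi> q) (snd x))"

definition J :: "(real ^ 'd) \<times> (real ^ 'd) \<Rightarrow> (real ^ 'd) \<times> (real ^ 'd)" where
  "J x = (- snd x, fst x)"

text \<open>Distributional form of \<open>\<partial>\<^sub>t \<mu>\<^sub>t + \<nabla> \<cdot> (v\<^sub>t \<mu>\<^sub>t) = - \<epsilon> \<bar>v\<^sub>t\<bar> \<mu>\<^sub>t\<close> on \<open>(0, T) \<times> \<real>\<^sup>D\<close>: the equation is
  multiplied by \<open>\<phi>\<close> and integrated by parts. Since Bochner integrals of non-integrable functions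
  are \<open>0\<close> by convention, integrability is part of the definition.\<close>

definition deficient_continuity_eq ::
  "real \<Rightarrow> real \<Rightarrow> (real \<Rightarrow> 'x \<Rightarrow> 'x) \<Rightarrow> (real \<Rightarrow> ('x::euclidean_space) measure) \<Rightarrow> bool" where
  "deficient_continuity_eq \<epsilon> T v \<mu> \<longleftrightarrow>
    (\<forall>\<phi>\<in>test_functions ({0<..<T} \<times> UNIV).
      let transport = (\<lambda>t x. deriv (\<lambda>s. \<phi> (s, x)) t + v t x \<bullet> grad (\<lambda>y. \<phi> (t, y)) x);
          loss = (\<lambda>t x. \<epsilon> * norm (v t x) * \<phi> (t, x))
      in (\<forall>t\<in>{0<..<T}. integrable (\<mu> t) (transport t) \<and> integrable (\<mu> t) (loss t)) \<and>
         set_integrable lborel {0<..<T} (\<lambda>t. \<integral>x. transport t x \<partial>\<mu> t) \<and>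
         set_integrable lborel {0<..<T} (\<lambda>t. \<integral>x. loss t x \<partial>\<mu> t) \<and>
         (LINT t:{0<..<T}|lborel. \<integral>x. transport t x \<partial>\<mu> t) =
         (LINT t:{0<..<T}|lborel. \<integral>x. loss t x \<partial>\<mu> t))"

definition narrowly_continuous_on :: "real set \<Rightarrow> (real \<Rightarrow> ('x::euclidean_space) measure) \<Rightarrow> bool" where
  "narrowly_continuous_on S \<mu> \<longleftrightarrow>
    (\<forall>\<phi> :: 'x \<Rightarrow> real. continuous_on UNIV \<phi> \<longrightarrow> bounded (range \<phi>) \<longrightarrow>
      continuous_on S (\<lambda>t. \<integral>x. \<phi> x \<partial>\<mu> t))"

end

theory Submission
  imports Defs "HOL-Complex_Analysis.Great_Picard"
begin

text \<open>Given a bounded Lipschitz force \<open>g\<close>, transport \<open>\<mu>\<^sub>0\<close> along the characteristics and let each of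
  them lose mass at the rate \<open>\<epsilon>\<close> per unit of arc length. As \<open>\<nabla>\<Phi>\<close> may grow arbitrarily fast, a
  characteristic can escape to infinity in finite time, but its length is then infinite and its mass has
  dropped to \<open>0\<close>; moreover \<open>exp (\<alpha> \<bar>x\<bar>)\<close> times the mass decreases along it because \<open>\<alpha> \<le> \<epsilon>\<close>. The
  remaining condition is that \<open>g\<close> be the force generated by the transported measure. The generated
  force depends causally on \<open>g\<close> and is equicontinuous, uniformly in \<open>g\<close>: a characteristic that has
  become long carries little mass, and all others have bounded speed. Hence the equation with a time
  delay is solved step by step, and by the theorem of Arzela and Ascoli a subsequence converges
  locally uniformly to a self-consistent force as the delay tends to \<open>0\<close>. No uniqueness or
  contraction is available, since no Lipschitz bound on \<open>\<nabla>\<Phi>\<close> is uniform in space.\<close>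

section \<open>Ordinary differential equations\<close>

text \<open>The force coming from Phi is only locally Lipschitz, so no estimate for characteristics
  is uniform in space; the loss of mass has to make up for this. A trajectory from x that is longer
  than N - |x| has weight at most exp (- \<epsilon> (N - |x|)), whatever the force and the time. The
  average of this bound over \<open>\<mu>\<^sub>0\<close> is \<open>Tail N\<close>, which tends to
  0. A shorter trajectory sees only the ball of radius N, where all constants can be chosen
  independently of the mean-field force. Hence every estimate has two terms: a multiple of
  \<open>Tail N\<close>, and a classical ODE estimate whose constants depend on N. Choosing N first
  and the remaining parameters afterwards yields equicontinuity and continuous dependence, though
  without a rate. The compact support of W makes grad W bounded and globally Lipschitz. Averaging
  against mass at most 1 keeps both constants, so generated forces stay in one fixed class. All
  averages are weighted integrals over initial points; the transported measures themselves are built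
  only after the force has been found.\<close>

definition ode_sol :: "(real \<Rightarrow> 'a::real_normed_vector \<Rightarrow> 'a) \<Rightarrow> 'a \<Rightarrow> (real \<Rightarrow> 'a) \<Rightarrow> bool" where
  "ode_sol F z Z \<longleftrightarrow>
    Z 0 = z \<and> (\<forall>t\<ge>0. (Z has_vector_derivative F t (Z t)) (at t within {0..}))"

lemma indefinite_integral_has_vector_derivative_atLeast:
  fixes h :: "real \<Rightarrow> 'a::euclidean_space"
  assumes "continuous_on UNIV h" "0 \<le> t"
  shows "((\<lambda>t. integral {0..t} h) has_vector_derivative h t) (at t within {0..})"
proof -
  have "((\<lambda>t. integral {0..t} h) has_vector_derivative h t) (at t within {0..t+1})"
    by (rule integral_has_vector_derivative)
       (use assms in \<open>auto intro: continuous_on_subset\<close>)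
  moreover have "at t within {0..t+1} = at t within {0..}"
    by (rule at_within_nhd[of t "{..<t+1}"]) (use assms in auto)
  ultimately show ?thesis by simp
qed

lemma ode_sol_continuous:
  assumes "ode_sol F z Z"
  shows "continuous_on {0..} Z"
  unfolding continuous_on_eq_continuous_within
  using assms unfolding ode_sol_def
  by (auto intro!: has_vector_derivative_continuous)

lemma ode_sol_at:
  assumes "ode_sol F z Z" "0 < t"
  shows "(Z has_vector_derivative F t (Z t)) (at t)"
proof -
  have "(Z has_vector_derivative F t (Z t)) (at t within {0..})"
    using assms by (auto simp: ode_sol_def)
  moreover have "at t within {0..} = at t"
    by (rule at_within_interior) (use assms in auto)
  ultimately show ?thesis by simp
qed

text \<open>A Picard iteration that is a contraction on all of \<open>[0, \<infinity>)\<close> because the unknown is rescaled by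
  \<open>exp (- c t)\<close> with \<open>c\<close> larger than twice the Lipschitz constant.\<close>

lemma ode_sol_exists:
  fixes F :: "real \<Rightarrow> 'a::euclidean_space \<Rightarrow> 'a"
  assumes cont: "continuous_on UNIV (\<lambda>(t, z). F t z)"
    and B: "\<And>t z. norm (F t z) \<le> B"
    and L: "\<And>t z w. norm (F t z - F t w) \<le> L * norm (z - w)"
  shows "\<exists>Z. ode_sol F z Z"
proof -
  have "0 \<le> norm (F 0 0)" by simp
  also have "\<dots> \<le> B" by (rule B)
  finally have B0: "0 \<le> B" .
  \<comment> \<open>The summand 1 keeps \<open>c\<close> positive when L = 0, and
    \<open>c \<ge> 1\<close> is what the bound \<open>s \<le> exp (c * s)\<close> below rests
    on.\<close>
  define c where "c = 2 * \<bar>L\<bar> + 1"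
  have c: "c \<ge> 1" "c > 0" "2 * \<bar>L\<bar> \<le> c" by (auto simp: c_def)
  have L': "norm (F t z - F t w) \<le> \<bar>L\<bar> * norm (z - w)" for t z w
    using L[of t z w] by (rule order_trans) (auto intro!: mult_right_mono)
  have Fcont: "continuous_on S (\<lambda>s. F s (u s))" if "continuous_on S u" for u :: "real \<Rightarrow> 'a" and S
    using continuous_on_compose2[OF cont continuous_on_Pair[OF continuous_on_id that]] by simp
  define I where "I y t = z + integral {0..t} (\<lambda>s. F s (exp (c * s) *\<^sub>R apply_bcontfun y s))"
    for y :: "real \<Rightarrow>\<^sub>C 'a" and t
  \<comment> \<open>Bounded continuous functions are defined on the whole line, so the iterate is
    frozen at negative times. The exponential factor outweighs the at most linear growth of
    \<open>I y\<close>, which keeps the iterate bounded.\<close>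
  define P0 where "P0 y t = exp (- (c * max 0 t)) *\<^sub>R I y (max 0 t)" for y t
  have hcont: "continuous_on S (\<lambda>s. F s (exp (c * s) *\<^sub>R apply_bcontfun y s))" for y S
    by (intro Fcont continuous_intros continuous_on_apply_bcontfun)
  have I_deriv: "(I y has_vector_derivative F t (exp (c * t) *\<^sub>R apply_bcontfun y t)) (at t within {0..})"
    if "t \<ge> 0" for y t
  proof -
    have "((\<lambda>t. z + integral {0..t} (\<lambda>s. F s (exp (c * s) *\<^sub>R apply_bcontfun y s)))
        has_vector_derivative (0 + F t (exp (c * t) *\<^sub>R apply_bcontfun y t))) (at t within {0..})"
      using indefinite_integral_has_vector_derivative_atLeast[OF hcont that]
      by (intro derivative_intros)
    then show ?thesis by (simp add: I_def[abs_def])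
  qed
  have I_cont: "continuous_on {0..} (I y)" for y
    unfolding continuous_on_eq_continuous_within
    using I_deriv by (auto intro!: has_vector_derivative_continuous)
  have P0_bound: "norm (P0 y t) \<le> norm z + B" for y t
  proof -
    define s where "s = max 0 t"
    have s: "0 \<le> s" by (simp add: s_def)
    have "norm (integral {0..s} (\<lambda>s. F s (exp (c * s) *\<^sub>R apply_bcontfun y s))) \<le> B * (s - 0)"
      by (rule integral_bound) (use s hcont B in auto)
    then have "norm (I y s) \<le> norm z + B * s"
      unfolding I_def using norm_triangle_ineq[of z] by (smt (verit))
    moreover have "s \<le> exp (c * s)"
      using c s exp_ge_add_one_self[of "c * s"] mult_right_mono[of 1 c s] by linarith
    then have "B * s \<le> B * exp (c * s)" using B0 by (intro mult_left_mono)
    moreover have "norm z \<le> norm z * exp (c * s)"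
      using s c mult_left_mono[of 1 "exp (c * s)" "norm z"] by simp
    ultimately have "norm (I y s) \<le> (norm z + B) * exp (c * s)"
      by (simp add: algebra_simps)
    then have "exp (- (c * s)) * norm (I y s) \<le> exp (- (c * s)) * ((norm z + B) * exp (c * s))"
      by (intro mult_left_mono) auto
    also have "\<dots> = norm z + B" by (simp add: exp_minus field_simps)
    finally show ?thesis by (simp add: P0_def s_def)
  qed
  have P0_cont: "continuous_on UNIV (P0 y)" for y
    unfolding P0_def
    by (intro continuous_intros continuous_on_compose2[OF I_cont]) auto
  have P0_in: "P0 y \<in> bcontfun" for y
    using P0_cont P0_bound by (rule bcontfun_normI)
  define P where "P y = Bcontfun (P0 y)" for y
  have P: "apply_bcontfun (P y) = P0 y" for y
    by (simp add: P_def Bcontfun_inverse P0_in)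
  have "\<exists>!y. P y = y"
  proof (rule banach_fix_type[of "1/2"]; (intro allI)?)
    fix y w :: "real \<Rightarrow>\<^sub>C 'a"
    define d where "d = dist y w"
    have d: "norm (apply_bcontfun y s - apply_bcontfun w s) \<le> d" for s
      using dist_bounded[of y s w] by (simp add: d_def dist_norm)
    have "dist (P0 y t) (P0 w t) \<le> 1/2 * d" for t
    proof -
      define s where "s = max 0 t"
      have s: "0 \<le> s" by (simp add: s_def)
      let ?h = "\<lambda>y s. F s (exp (c * s) *\<^sub>R apply_bcontfun y s)"
      have int: "((\<lambda>r. \<bar>L\<bar> * d * exp (c * r)) has_integral \<bar>L\<bar> * d * (exp (c * s) / c) - \<bar>L\<bar> * d * (exp (c * 0) / c)) {0..s}"
        by (rule fundamental_theorem_of_calculus)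
           (use s c in \<open>auto intro!: derivative_eq_intros simp: has_real_derivative_iff_has_vector_derivative[symmetric]\<close>)
      have "norm (integral {0..s} (\<lambda>r. ?h y r - ?h w r)) \<le> integral {0..s} (\<lambda>r. \<bar>L\<bar> * d * exp (c * r))"
      proof (rule integral_norm_bound_integral)
        show "(\<lambda>r. ?h y r - ?h w r) integrable_on {0..s}"
          by (intro integrable_continuous_real continuous_on_diff hcont)
        show "(\<lambda>r. \<bar>L\<bar> * d * exp (c * r)) integrable_on {0..s}" using int by blast
        fix r
        have "norm (?h y r - ?h w r) \<le> \<bar>L\<bar> * norm (exp (c * r) *\<^sub>R (apply_bcontfun y r - apply_bcontfun w r))"
          using L' by (simp add: scaleR_diff_right)
        also have "\<dots> \<le> \<bar>L\<bar> * (exp (c * r) * d)"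
          by (intro mult_left_mono) (auto intro!: mult_left_mono d)
        finally show "norm (?h y r - ?h w r) \<le> \<bar>L\<bar> * d * exp (c * r)" by (simp add: mult_ac)
      qed
      also have "\<dots> = \<bar>L\<bar> * d * (exp (c * s) / c) - \<bar>L\<bar> * d * (exp (c * 0) / c)"
        using int by (rule integral_unique)
      also have "\<dots> \<le> \<bar>L\<bar> * d * (exp (c * s) / c)"
        using c by (simp add: d_def)
      also have "\<dots> = (2 * \<bar>L\<bar>) * (d * exp (c * s) / (2 * c))" by simp
      also have "\<dots> \<le> c * (d * exp (c * s) / (2 * c))"
        by (intro mult_right_mono c) (use c in \<open>auto simp: d_def\<close>)
      also have "\<dots> = d * exp (c * s) / 2" using c by simp
      finally have "norm (I y s - I w s) \<le> d * exp (c * s) / 2"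
        unfolding I_def by (simp add: integral_diff integrable_continuous_real hcont)
      then have "exp (- (c * s)) * norm (I y s - I w s) \<le> exp (- (c * s)) * (d * exp (c * s) / 2)"
        by (intro mult_left_mono) auto
      also have "\<dots> = 1/2 * d" by (simp add: exp_minus field_simps)
      finally show ?thesis
        by (simp add: P0_def s_def dist_norm flip: scaleR_diff_right)
    qed
    then show "dist (P y) (P w) \<le> 1/2 * dist y w"
      by (intro dist_bound) (auto simp: P d_def)
  qed auto
  then obtain y where "P y = y" by blast
  then have y: "apply_bcontfun y t = P0 y t" for t
    using P[of y] by simp
  define Z where "Z t = exp (c * t) *\<^sub>R apply_bcontfun y t" for t
  have ZI: "Z t = I y t" if "t \<ge> 0" for t
    using that by (simp add: Z_def y P0_def exp_minus)
  have "ode_sol F z Z"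
    unfolding ode_sol_def
  proof (intro conjI allI impI)
    show "Z 0 = z" by (simp add: ZI I_def)
    fix t :: real assume t: "t \<ge> 0"
    show "(Z has_vector_derivative F t (Z t)) (at t within {0..})"
      by (rule has_vector_derivative_transform[OF _ _ I_deriv[OF t, of y, folded Z_def]])
         (use t ZI in auto)
  qed
  then show ?thesis by blast
qed

text \<open>A squared form of Gronwall's inequality: \<open>u = \<parallel>Z - Y\<parallel>\<^sup>2\<close> satisfies
  \<open>u' \<le> (2 L + 1) u + \<delta>\<^sup>2\<close>.\<close>

lemma ode_stability:
  fixes Z Y :: "real \<Rightarrow> 'a::euclidean_space"
  assumes Z: "ode_sol F z Z" and Y: "ode_sol G y Y" and T: "0 \<le> T"
    and le: "\<And>t. 0 < t \<Longrightarrow> t < T \<Longrightarrow> norm (F t (Z t) - G t (Y t)) \<le> L * norm (Z t - Y t) + \<delta>"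
  shows "(norm (Z T - Y T))\<^sup>2 \<le> ((norm (z - y))\<^sup>2 + \<delta>\<^sup>2 * T) * exp ((2 * \<bar>L\<bar> + 1) * T)"
proof -
  define c where "c = 2 * \<bar>L\<bar> + 1"
  \<comment> \<open>Squaring avoids the kink of the norm at 0. In \<open>w\<close>, the factor
    \<open>exp (- (c * t))\<close> absorbs the linear term and the subtracted
    \<open>\<delta>\<^sup>2 * t\<close> the inhomogeneity, so that \<open>w\<close> is
    nonincreasing.\<close>
  define u where "u t = (norm (Z t - Y t))\<^sup>2" for t
  define w where "w t = u t * exp (- (c * t)) - \<delta>\<^sup>2 * t" for t
  have "w T \<le> w 0"
  proof (cases "T = 0")
    case False
    then have T': "0 < T" using T by simp
    show ?thesis
    proof (rule DERIV_nonpos_imp_decreasing_open[OF T])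
      show "continuous_on {0..T} w"
        unfolding w_def u_def
        by (intro continuous_intros continuous_on_subset[OF ode_sol_continuous[OF Z]]
            continuous_on_subset[OF ode_sol_continuous[OF Y]]) auto
      fix t assume t: "0 < t" "t < T"
      let ?D = "Z t - Y t" and ?E = "F t (Z t) - G t (Y t)"
      have du: "(u has_real_derivative 2 * (?D \<bullet> ?E)) (at t)"
      proof -
        have "((\<lambda>t. Z t - Y t) has_vector_derivative ?E) (at t)"
          using ode_sol_at[OF Z t(1)] ode_sol_at[OF Y t(1)] by (intro derivative_intros)
        then have *: "((\<lambda>t. Z t - Y t) has_derivative (\<lambda>x. x *\<^sub>R ?E)) (at t)"
          by (simp add: has_vector_derivative_def)
        show ?thesis
          unfolding has_field_derivative_def u_def power2_norm_eq_inner
          by (rule has_derivative_eq_rhs[OF has_derivative_inner[OF * *]])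
             (auto simp: inner_commute algebra_simps)
      qed
      have dw: "(w has_real_derivative (2 * (?D \<bullet> ?E) - c * u t) * exp (- (c * t)) - \<delta>\<^sup>2) (at t)"
        unfolding w_def[abs_def]
        by (auto intro!: derivative_eq_intros du simp: algebra_simps)
      have "2 * (?D \<bullet> ?E) \<le> 2 * (norm ?D * norm ?E)"
        using norm_cauchy_schwarz[of ?D ?E] by simp
      also have "\<dots> \<le> 2 * (norm ?D * (\<bar>L\<bar> * norm ?D + \<delta>))"
      proof -
        have "norm ?E \<le> \<bar>L\<bar> * norm ?D + \<delta>"
          using le[OF t] mult_right_mono[OF abs_ge_self norm_ge_zero, of L ?D] by linarith
        then show ?thesis by (intro mult_left_mono) auto
      qed
      also have "\<dots> \<le> c * u t + \<delta>\<^sup>2"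
        using sum_squares_bound[of "norm ?D" \<delta>]
        by (simp add: c_def u_def algebra_simps power2_eq_square)
      finally have "2 * (?D \<bullet> ?E) - c * u t \<le> \<delta>\<^sup>2" by simp
      then have "(2 * (?D \<bullet> ?E) - c * u t) * exp (- (c * t)) \<le> \<delta>\<^sup>2 * exp (- (c * t))"
        by (intro mult_right_mono) auto
      also have "\<dots> \<le> \<delta>\<^sup>2 * 1"
        by (intro mult_left_mono) (use t in \<open>auto simp: c_def\<close>)
      finally show "\<exists>y. (w has_real_derivative y) (at t) \<and> y \<le> 0"
        using dw by (intro exI conjI) auto
    qed
  qed simp
  then have "u T * exp (- (c * T)) \<le> u 0 + \<delta>\<^sup>2 * T"
    by (simp add: w_def)
  then have "u T * exp (- (c * T)) * exp (c * T) \<le> (u 0 + \<delta>\<^sup>2 * T) * exp (c * T)"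
    by (intro mult_right_mono) auto
  moreover have "u 0 = (norm (z - y))\<^sup>2"
    using Z Y by (simp add: u_def ode_sol_def)
  moreover have "u T * exp (- (c * T)) * exp (c * T) = u T"
    by (simp add: exp_minus)
  ultimately show ?thesis
    by (metis c_def u_def)
qed

lemma ode_sol_bound:
  fixes Z :: "real \<Rightarrow> 'a::euclidean_space"
  assumes Z: "ode_sol F z Z" and B: "\<And>t. t \<ge> 0 \<Longrightarrow> norm (F t (Z t)) \<le> B" and "0 \<le> s" "0 \<le> t"
  shows "norm (Z t - Z s) \<le> B * \<bar>t - s\<bar>"
proof -
  have "norm (Z t - Z s) \<le> B * norm (t - s)"
  proof (rule differentiable_bound)
    show "convex {0::real..}" by simp
    show "(Z has_derivative (\<lambda>h. h *\<^sub>R F r (Z r))) (at r within {0..})" if "r \<in> {0..}" for r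
      using Z that by (auto simp: ode_sol_def has_vector_derivative_def)
    show "onorm (\<lambda>h. h *\<^sub>R F r (Z r)) \<le> B" if "r \<in> {0..}" for r
      using mult_right_mono[OF B[of r], of "\<bar>h\<bar>" for h] that
      by (intro onorm_le) (auto simp: mult.commute)
  qed (use assms in auto)
  then show ?thesis by simp
qed

section \<open>Gradients of C2 functions\<close>

lemma Ck_continuous: "Ck k f \<Longrightarrow> continuous_on UNIV f"
  by (cases k) (auto intro: differentiable_imp_continuous_on)

lemma has_derivative_grad:
  assumes "f differentiable (at x)"
  shows "(f has_derivative (\<lambda>h. grad f x \<bullet> h)) (at x)"
proof -
  let ?D = "frechet_derivative f (at x)"
  have D: "(f has_derivative ?D) (at x)" using assms by (simp add: frechet_derivative_works)
  then interpret D: bounded_linear ?D by (rule has_derivative_bounded_linear)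
  have "?D h = grad f x \<bullet> h" for h
  proof -
    have "?D h = ?D (\<Sum>i\<in>Basis. (h \<bullet> i) *\<^sub>R i)" by (simp add: euclidean_representation)
    also have "\<dots> = grad f x \<bullet> h"
      by (simp add: D.sum D.scaleR grad_def inner_sum_left inner_sum_right inner_commute mult.commute)
    finally show ?thesis .
  qed
  then have "?D = (\<lambda>h. grad f x \<bullet> h)" by blast
  then show ?thesis using D by simp
qed

lemma grad_eqI:
  assumes "(f has_derivative (\<lambda>h. G \<bullet> h)) (at x)"
  shows "grad f x = G"
  unfolding grad_def frechet_derivative_at[OF assms, symmetric] by (rule euclidean_representation)

lemma Ck_Suc_differentiable: "Ck (Suc k) f \<Longrightarrow> f differentiable (at x)"
  by (auto simp: differentiable_on_def)

lemma grad_inner_Basis: "i \<in> Basis \<Longrightarrow> grad f x \<bullet> i = frechet_derivative f (at x) i"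
  by (simp add: grad_def)

lemma Ck_grad_continuous:
  assumes "Ck (Suc k) f"
  shows "continuous_on UNIV (grad f)"
  unfolding grad_def using assms by (intro continuous_intros) (auto intro: Ck_continuous)

lemma Ck_Suc_lipschitz:
  fixes f :: "'a::euclidean_space \<Rightarrow> real"
  assumes f: "Ck (Suc k) f"
  obtains B where "0 \<le> B"
    "\<And>x y. x \<in> cball 0 R \<Longrightarrow> y \<in> cball 0 R \<Longrightarrow> \<bar>f x - f y\<bar> \<le> B * norm (x - y)"
proof -
  have "bounded (grad f ` cball 0 R)"
    by (intro compact_imp_bounded compact_continuous_image
        continuous_on_subset[OF Ck_grad_continuous[OF f]]) auto
  then obtain B where B: "0 < B" "\<And>x. x \<in> cball 0 R \<Longrightarrow> norm (grad f x) \<le> B"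
    by (auto simp: bounded_pos)
  show thesis
  proof (rule that[of B])
    fix x y :: 'a assume xy: "x \<in> cball 0 R" "y \<in> cball 0 R"
    have "norm (f x - f y) \<le> B * norm (x - y)"
    proof (rule differentiable_bound[OF convex_cball _ _ xy(1) xy(2)])
      show "(f has_derivative (\<lambda>h. grad f z \<bullet> h)) (at z within cball 0 R)" for z
        using has_derivative_grad[OF Ck_Suc_differentiable[OF f]] by (rule has_derivative_at_withinI)
      show "onorm (\<lambda>h. grad f z \<bullet> h) \<le> B" if "z \<in> cball 0 R" for z
        using Cauchy_Schwarz_ineq2[of "grad f z"] mult_right_mono[OF B(2)[OF that] norm_ge_zero]
        by (intro onorm_le) (auto intro: order_trans)
    qed
    then show "\<bar>f x - f y\<bar> \<le> B * norm (x - y)" by simp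
  qed (use B in simp)
qed

lemma Ck2_grad_lipschitz:
  fixes f :: "'a::euclidean_space \<Rightarrow> real"
  assumes f: "Ck 2 f"
  obtains B where "0 \<le> B"
    "\<And>x y. x \<in> cball 0 R \<Longrightarrow> y \<in> cball 0 R \<Longrightarrow> norm (grad f x - grad f y) \<le> B * norm (x - y)"
proof -
  have "\<exists>B. 0 \<le> B \<and> (\<forall>x\<in>cball 0 R. \<forall>y\<in>cball 0 R.
      \<bar>frechet_derivative f (at x) i - frechet_derivative f (at y) i\<bar> \<le> B * norm (x - y))" if "i \<in> Basis" for i
  proof -
    have "Ck (Suc 0) (\<lambda>x. frechet_derivative f (at x) i)"
      using f that by (simp add: numeral_2_eq_2)
    from Ck_Suc_lipschitz[OF this, of R] show ?thesis by metis
  qed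
  then obtain B where B: "\<And>i. i \<in> Basis \<Longrightarrow> 0 \<le> B i"
    "\<And>i x y. i \<in> Basis \<Longrightarrow> x \<in> cball 0 R \<Longrightarrow> y \<in> cball 0 R \<Longrightarrow>
      \<bar>frechet_derivative f (at x) i - frechet_derivative f (at y) i\<bar> \<le> B i * norm (x - y)"
    by metis
  show thesis
  proof (rule that[of "sum B Basis"])
    fix x y :: 'a assume xy: "x \<in> cball 0 R" "y \<in> cball 0 R"
    have "norm (grad f x - grad f y) \<le> (\<Sum>i\<in>Basis. \<bar>(grad f x - grad f y) \<bullet> i\<bar>)"
      by (rule norm_le_l1)
    also have "\<dots> \<le> (\<Sum>i\<in>Basis. B i * norm (x - y))"
      using B(2)[OF _ xy] by (intro sum_mono) (simp add: inner_diff_left grad_inner_Basis)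
    finally show "norm (grad f x - grad f y) \<le> sum B Basis * norm (x - y)"
      by (simp add: sum_distrib_right)
  qed (use B in \<open>auto intro: sum_nonneg\<close>)
qed

lemma eq_0_outside_supp: "x \<notin> supp f \<Longrightarrow> f x = 0"
  using closure_subset[of "{x. f x \<noteq> 0}"] by (auto simp: supp_def)

lemma grad_0_outside_supp:
  assumes "x \<notin> supp f"
  shows "grad f x = 0"
proof (rule grad_eqI)
  have "((\<lambda>_. 0) has_derivative (\<lambda>h. 0 \<bullet> h)) (at x)" by simp
  then show "(f has_derivative (\<lambda>h. 0 \<bullet> h)) (at x)"
  proof (rule has_derivative_transform_within_open[where s = "- supp f"])
    show "open (- supp f)" by (simp add: supp_def open_Compl)
    show "0 = f y" if "y \<in> - supp f" for y
      using eq_0_outside_supp[of y f] that by simp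
  qed (use assms in simp)
qed

lemma compactly_supported_bounded:
  fixes f :: "'a::topological_space \<Rightarrow> 'b::real_normed_vector"
  assumes "continuous_on UNIV f" "compact S" "\<And>x. x \<notin> S \<Longrightarrow> f x = 0"
  shows "\<exists>B. \<forall>x. norm (f x) \<le> B"
proof -
  have "bounded (f ` S)"
    by (intro compact_imp_bounded compact_continuous_image continuous_on_subset[OF assms(1)] assms(2)) auto
  then obtain B where B: "0 < B" "\<And>x. x \<in> S \<Longrightarrow> norm (f x) \<le> B" by (auto simp: bounded_pos)
  have "norm (f x) \<le> B" for x
    using B assms(3)[of x] by (cases "x \<in> S") auto
  then show ?thesis by blast
qed

text \<open>On a ball slightly larger than the support the local Lipschitz bound applies. If one
  point lies outside that ball, either both gradients vanish or the other point is in the support,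
  at distance at least 1, and then the sup bound \<open>C\<close> does the work of a Lipschitz
  constant.\<close>

lemma compact_support_grad:
  assumes f: "Ck 2 f" and supp: "compact (supp f)"
  obtains C L where "\<And>x. norm (grad f x) \<le> C" "\<And>x y. norm (grad f x - grad f y) \<le> L * norm (x - y)"
proof -
  have f': "Ck (Suc (Suc 0)) f" using f by (simp add: numeral_2_eq_2)
  obtain C where C: "\<And>x. norm (grad f x) \<le> C"
    using compactly_supported_bounded[OF Ck_grad_continuous[OF f'] supp grad_0_outside_supp[where f = f]] by blast
  have C0: "0 \<le> C" using norm_ge_zero C by (rule order_trans)
  obtain R where R: "\<And>x. x \<in> supp f \<Longrightarrow> norm x \<le> R"
    using compact_imp_bounded[OF supp] by (auto simp: bounded_iff)
  obtain B where B: "0 \<le> B"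
    "\<And>x y. x \<in> cball 0 (R + 1) \<Longrightarrow> y \<in> cball 0 (R + 1) \<Longrightarrow> norm (grad f x - grad f y) \<le> B * norm (x - y)"
    using Ck2_grad_lipschitz[OF f] by blast
  have far: "norm (grad f x - grad f y) \<le> (B + C) * norm (x - y)" if y: "R + 1 < norm y" for x y
  proof (cases "x \<in> supp f")
    case True
    have "y \<notin> supp f" using R[of y] y by auto
    then have "norm (grad f x - grad f y) \<le> C * 1" using C[of x] by (simp add: grad_0_outside_supp)
    also have "\<dots> \<le> (B + C) * norm (x - y)"
      using R[OF True] y norm_triangle_ineq3[of x y] B(1) C0 by (intro mult_mono) auto
    finally show ?thesis .
  next
    case False
    have "y \<notin> supp f" using R[of y] y by auto
    then show ?thesis using False B(1) C0 by (simp add: grad_0_outside_supp)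
  qed
  have "norm (grad f x - grad f y) \<le> (B + C) * norm (x - y)" for x y
  proof (cases "R + 1 < norm x \<or> R + 1 < norm y")
    case True
    then show ?thesis using far[of x y] far[of y x] by (auto simp: norm_minus_commute)
  next
    case False
    then have "norm (grad f x - grad f y) \<le> B * norm (x - y)" by (intro B) auto
    also have "\<dots> \<le> (B + C) * norm (x - y)" using C0 by (intro mult_right_mono) auto
    finally show ?thesis .
  qed
  with C show thesis by (rule that)
qed

section \<open>Differentiability of the mean-field potential\<close>

lemma grad_remainder_le:
  assumes diff: "\<And>x. f differentiable (at x)"
    and L: "\<And>x y. norm (grad f x - grad f y) \<le> L * norm (x - y)"
  shows "\<bar>f y - f x - grad f x \<bullet> (y - x)\<bar> \<le> L * norm (y - x) * norm (y - x)"
proof -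
  define r where "r z = f z - grad f x \<bullet> z" for z
  have "norm (r y - r x) \<le> L * norm (y - x) * norm (y - x)"
  proof (rule differentiable_bound[OF convex_closed_segment[of x y]])
    fix z assume z: "z \<in> closed_segment x y"
    have "(r has_derivative (\<lambda>h. (grad f z - grad f x) \<bullet> h)) (at z)"
      unfolding r_def inner_diff_left
      by (intro has_derivative_diff has_derivative_grad diff has_derivative_inner_right has_derivative_ident)
    then show "(r has_derivative (\<lambda>h. (grad f z - grad f x) \<bullet> h)) (at z within closed_segment x y)"
      by (rule has_derivative_at_withinI)
    have "norm (grad f z - grad f x) \<le> L * norm (y - x)"
    proof -
      obtain u where u: "0 \<le> u" "u \<le> 1" "z - x = u *\<^sub>R (y - x)"
        using z by (auto simp: in_segment algebra_simps)
      have "norm (grad f z - grad f x) \<le> u * (L * norm (y - x))"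
        using L[of z x] u by (simp add: mult_ac)
      moreover have "0 \<le> L * norm (y - x)" using L[of y x] norm_ge_zero order_trans by blast
      then have "u * (L * norm (y - x)) \<le> 1 * (L * norm (y - x))" using u by (intro mult_right_mono)
      ultimately show ?thesis by simp
    qed
    then show "onorm (\<lambda>h. (grad f z - grad f x) \<bullet> h) \<le> L * norm (y - x)"
      by (intro onorm_le) (simp add: order_trans[OF Cauchy_Schwarz_ineq2] mult_right_mono)
  qed auto
  then show ?thesis by (simp add: r_def inner_diff_right algebra_simps)
qed

text \<open>Differentiation under the integral sign: the quadratic bound on the Taylor remainder of
  \<open>W\<close> has the same constant at every base point, so integrating it costs only the total
  mass of the measure.\<close>

lemma convol_has_derivative:
  fixes W :: "real ^ 'd \<Rightarrow> real"
  assumes "finite_measure \<mu>" and sets: "sets \<mu> = sets borel"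
    and W: "Ck 2 W" "compact (supp W)"
  shows "(convol W \<mu> has_derivative (\<lambda>h. (\<integral>x. grad W (q - snd x) \<partial>\<mu>) \<bullet> h)) (at q)"
proof -
  interpret finite_measure \<mu> by fact
  have meas: "measurable \<mu> M = measurable borel M" for M by (rule measurable_cong_sets[OF sets refl])
  have W': "Ck (Suc (Suc 0)) W" using W by (simp add: numeral_2_eq_2)
  note diff = Ck_Suc_differentiable[OF W']
  obtain C L where C: "\<And>x. norm (grad W x) \<le> C" and L: "\<And>x y. norm (grad W x - grad W y) \<le> L * norm (x - y)"
    using compact_support_grad[OF W] by blast
  obtain B where B: "\<And>x. norm (W x) \<le> B"
    using compactly_supported_bounded[OF Ck_continuous[OF W(1)] W(2) eq_0_outside_supp[where f = W]] by blast
  have [measurable]: "(\<lambda>x :: (real ^ 'd) \<times> (real ^ 'd). W (r - snd x)) \<in> borel_measurable borel"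
    "(\<lambda>x :: (real ^ 'd) \<times> (real ^ 'd). grad W (r - snd x)) \<in> borel_measurable borel" for r
    by (intro borel_measurable_continuous_onI continuous_on_compose2[OF Ck_continuous[OF W(1)]]
        continuous_on_compose2[OF Ck_grad_continuous[OF W']] continuous_intros; simp)+
  have int_W: "integrable \<mu> (\<lambda>x. W (r - snd x))" for r
    using B by (intro integrable_const_bound[of _ B] AE_I2) (simp_all add: meas)
  have int_grad: "integrable \<mu> (\<lambda>x. grad W (q - snd x))"
    using C by (intro integrable_const_bound[of _ C] AE_I2) (simp_all add: meas)
  let ?G = "\<integral>x. grad W (q - snd x) \<partial>\<mu>"
  have rem: "norm (convol W \<mu> r - convol W \<mu> q - ?G \<bullet> (r - q)) \<le> L * measure \<mu> (space \<mu>) * norm (r - q) * norm (r - q)" for r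
  proof -
    let ?rem = "\<lambda>x. W (r - snd x) - W (q - snd x) - grad W (q - snd x) \<bullet> (r - q)"
    have int: "integrable \<mu> ?rem" using int_W int_grad by auto
    have eq: "convol W \<mu> r - convol W \<mu> q - ?G \<bullet> (r - q) = (\<integral>x. ?rem x \<partial>\<mu>)"
      unfolding convol_def using int_W int_grad by simp
    have "norm (\<integral>x. ?rem x \<partial>\<mu>) \<le> (\<integral>x. norm (?rem x) \<partial>\<mu>)" by simp
    also have "\<dots> \<le> (\<integral>x. L * norm (r - q) * norm (r - q) \<partial>\<mu>)"
    proof (rule integral_mono)
      show "norm (?rem x) \<le> L * norm (r - q) * norm (r - q)" for x
        using grad_remainder_le[OF diff L, of "r - snd x" "q - snd x"] by simp
    qed (use int in auto)
    finally show ?thesis unfolding eq by (simp add: mult_ac)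
  qed
  show ?thesis
  proof (rule has_derivativeI_sandwich[of 1 _ _ _ _ "\<lambda>r. L * measure \<mu> (space \<mu>) * norm (r - q)"])
    show "bounded_linear (\<lambda>h. ?G \<bullet> h)" by (rule bounded_linear_inner_right)
    show "((\<lambda>r. L * measure \<mu> (space \<mu>) * norm (r - q)) \<longlongrightarrow> 0) (at q)"
      by (rule tendsto_eq_rhs, (rule tendsto_intros)+) simp
    fix r assume "r \<noteq> q"
    then show "norm (convol W \<mu> r - convol W \<mu> q - ?G \<bullet> (r - q)) / norm (r - q)
        \<le> L * measure \<mu> (space \<mu>) * norm (r - q)"
      using rem[of r] by (simp add: divide_simps)
  qed simp
qed

text \<open>Brings the Hamiltonian vector field into the form of \<open>vel\<close> below, with the
  mean-field force as an average of \<open>grad W\<close>.\<close>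

lemma J_grad_Ham_eq:
  fixes W \<Phi> :: "real ^ 'd \<Rightarrow> real"
  assumes "finite_measure \<mu>" "sets \<mu> = sets borel" "Ck 2 W" "compact (supp W)" "Ck 2 \<Phi>"
  shows "J (grad_Ham W \<Phi> \<mu> x) = (- ((\<integral>y. grad W (snd x - snd y) \<partial>\<mu>) + grad \<Phi> (snd x)), fst x)"
proof -
  have "\<Phi> differentiable (at q)" for q
    using assms(5) Ck_Suc_differentiable[of "Suc 0" \<Phi>] by (simp only: numeral_2_eq_2)
  then have "((\<lambda>q. convol W \<mu> q + \<Phi> q) has_derivative
      (\<lambda>h. ((\<integral>y. grad W (q - snd y) \<partial>\<mu>) + grad \<Phi> q) \<bullet> h)) (at q)" for q
    unfolding inner_add_left
    by (intro has_derivative_add convol_has_derivative has_derivative_grad assms)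
  from grad_eqI[OF this] show ?thesis
    by (simp add: J_def grad_Ham_def)
qed

text \<open>The distributional equation separates time and space derivatives, whereas the chain rule
  along a characteristic needs the total derivative of the test function.\<close>

lemma partial_derivatives:
  fixes \<phi> :: "real \<times> 'a::euclidean_space \<Rightarrow> real"
  assumes "\<phi> differentiable (at (t, x))"
  shows "deriv (\<lambda>s. \<phi> (s, x)) t = fst (grad \<phi> (t, x))"
    and "grad (\<lambda>y. \<phi> (t, y)) x = snd (grad \<phi> (t, x))"
proof -
  note D = has_derivative_grad[OF assms]
  have "((\<lambda>s. \<phi> (s, x)) has_derivative (\<lambda>h. grad \<phi> (t, x) \<bullet> (h, 0))) (at t)"
    by (rule has_derivative_compose[of "\<lambda>s. (s, x)", OF _ D]) (auto intro!: derivative_eq_intros)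
  then have "((\<lambda>s. \<phi> (s, x)) has_derivative (*) (fst (grad \<phi> (t, x)))) (at t)"
    by (rule has_derivative_eq_rhs) (simp add: inner_prod_def fun_eq_iff)
  then show "deriv (\<lambda>s. \<phi> (s, x)) t = fst (grad \<phi> (t, x))"
    by (intro DERIV_imp_deriv) (simp add: has_field_derivative_def)
  have "((\<lambda>y. \<phi> (t, y)) has_derivative (\<lambda>h. grad \<phi> (t, x) \<bullet> (0, h))) (at x)"
    by (rule has_derivative_compose[of "\<lambda>y. (t, y)", OF _ D]) (auto intro!: derivative_eq_intros)
  then show "grad (\<lambda>y. \<phi> (t, y)) x = snd (grad \<phi> (t, x))"
    by (intro grad_eqI) (simp add: inner_prod_def)
qed

section \<open>Damped flows\<close>

lemma norm_fst_le_norm: "norm (fst x) \<le> norm x"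
  by (metis norm_fst_le prod.collapse)

lemma norm_snd_le_norm: "norm (snd x) \<le> norm x"
  by (metis norm_snd_le prod.collapse)

lemma abs_exp_diff_le:
  fixes a b :: real
  assumes "a \<le> 0" "b \<le> 0"
  shows "\<bar>exp a - exp b\<bar> \<le> \<bar>a - b\<bar>"
proof -
  have "exp a - exp b \<le> a - b" if "b \<le> a" "a \<le> 0" for a b :: real
  proof -
    have "exp a * (1 - exp (b - a)) \<le> 1 * (1 - exp (b - a))"
      using that by (intro mult_right_mono) auto
    also have "\<dots> \<le> a - b" by (smt (verit) exp_ge_add_one_self)
    finally show ?thesis by (simp add: algebra_simps exp_diff)
  qed
  from this[of a b] this[of b a] show ?thesis
    using assms by (cases "b \<le> a") (auto simp: abs_if)
qed

text \<open>The moduli of continuity below divide by \<open>a + 1\<close> instead of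
  \<open>a\<close>, because the Lipschitz constant \<open>a\<close> may vanish.\<close>

lemma half_cancel: "0 \<le> a \<Longrightarrow> (a + 1) * (e / (2 * (a + 1))) = e / 2" for a e :: real
  by (simp add: divide_simps)

text \<open>The characteristics move with velocity \<open>(- (g + \<psi>), p)\<close>, where \<open>g\<close> is the mean-field
  force. Velocities are frozen outside large balls, and the arc length of a trajectory is carried along
  as an additional coordinate, since the mass transported by a trajectory of length \<open>l\<close> is
  \<open>exp (- \<epsilon> l)\<close>.\<close>

locale damped_flow =
  fixes K \<psi> :: "'q::euclidean_space \<Rightarrow> 'q" and C L \<epsilon> :: real and \<mu>\<^sub>0 :: "('q \<times> 'q) measure"
  assumes eps: "\<epsilon> > 0"
    and sets_mu0: "sets \<mu>\<^sub>0 = sets borel" and mass_mu0: "emeasure \<mu>\<^sub>0 UNIV = 1"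
    and K_bound: "\<And>q. norm (K q) \<le> C"
    and K_lip: "\<And>q r. norm (K q - K r) \<le> L * norm (q - r)"
    and psi_lip: "\<And>R. \<exists>B. \<forall>q\<in>cball 0 R. \<forall>r\<in>cball 0 R. norm (\<psi> q - \<psi> r) \<le> B * norm (q - r)"
begin

lemma space_mu0 [simp]: "space \<mu>\<^sub>0 = UNIV"
  using sets_eq_imp_space_eq[OF sets_mu0] by simp

sublocale finite_measure \<mu>\<^sub>0
  by standard (simp add: mass_mu0)

lemma measure_mu0 [simp]: "measure \<mu>\<^sub>0 UNIV = 1"
  using mass_mu0 by (simp add: measure_def)

lemma measurable_mu0 [simp]: "measurable \<mu>\<^sub>0 M = measurable borel M"
  by (rule measurable_cong_sets[OF sets_mu0 refl])

lemma C_nonneg: "0 \<le> C"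
  using norm_ge_zero K_bound by (rule order_trans)

lemma L_nonneg: "0 \<le> L"
proof -
  obtain b :: 'q where "b \<in> Basis" using nonempty_Basis by blast
  then have "0 \<le> L * norm (b - 0)" using K_lip[of b 0] norm_ge_zero order_trans by blast
  then show ?thesis using \<open>b \<in> Basis\<close> by simp
qed

text \<open>The constants are those of \<open>K\<close>, so that the class is mapped into itself by
  \<open>gforce\<close>. Time ranges over the whole line because delayed times may be
  negative.\<close>

definition force :: "(real \<Rightarrow> 'q \<Rightarrow> 'q) \<Rightarrow> bool" where
  "force g \<longleftrightarrow> continuous_on UNIV (\<lambda>(t, q). g t q) \<and> (\<forall>t q. norm (g t q) \<le> C) \<and>
    (\<forall>t q r. norm (g t q - g t r) \<le> L * norm (q - r))"

definition vel :: "(real \<Rightarrow> 'q \<Rightarrow> 'q) \<Rightarrow> real \<Rightarrow> 'q \<times> 'q \<Rightarrow> 'q \<times> 'q" where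
  "vel g t x = (- (g t (snd x) + \<psi> (snd x)), fst x)"

text \<open>The projection is nonexpansive and the identity on the ball. Composing with it turns a
  Lipschitz bound on the ball into a global one with the same constant, and makes the velocity
  bounded.\<close>

definition trunc :: "nat \<Rightarrow> 'q \<times> 'q \<Rightarrow> 'q \<times> 'q" where
  "trunc N = closest_point (cball 0 (real N))"

definition field :: "(real \<Rightarrow> 'q \<Rightarrow> 'q) \<Rightarrow> nat \<Rightarrow> real \<Rightarrow> ('q \<times> 'q) \<times> real \<Rightarrow> ('q \<times> 'q) \<times> real" where
  "field g N t z = (vel g t (trunc N (fst z)), norm (vel g t (trunc N (fst z))))"

lemma norm_trunc: "norm (trunc N x) \<le> N"
  using closest_point_in_set[of "cball 0 (real N)" x] by (simp add: trunc_def)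

lemma trunc_lip: "norm (trunc N x - trunc N y) \<le> norm (x - y)"
  using closest_point_lipschitz[of "cball 0 (real N)" x y] by (simp add: trunc_def dist_norm)

lemma trunc_id: "norm x \<le> N \<Longrightarrow> trunc N x = x"
  by (simp add: trunc_def closest_point_self)

text \<open>What matters is the order of quantifiers: the constants depend on \<open>N\<close> but
  not on \<open>g\<close>. The uniformity over all admissible forces, and with it the compactness
  argument, starts here.\<close>

lemma field_bounds:
  obtains \<Lambda> V where "0 \<le> \<Lambda>" "0 \<le> V"
    "\<And>g t z. force g \<Longrightarrow> norm (field g N t z) \<le> V"
    "\<And>g t z w. force g \<Longrightarrow> norm (field g N t z - field g N t w) \<le> \<Lambda> * norm (z - w)"
proof -
  obtain B where B: "\<And>q r. norm q \<le> N \<Longrightarrow> norm r \<le> N \<Longrightarrow> norm (\<psi> q - \<psi> r) \<le> B * norm (q - r)"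
    using psi_lip[of N] unfolding Ball_def mem_cball_0 by metis
  define \<Lambda> where "\<Lambda> = L + \<bar>B\<bar> + 1"
  define V where "V = C + norm (\<psi> 0) + \<bar>B\<bar> * N + N"
  have snd_le: "norm (snd x) \<le> N" if "norm x \<le> N" for x :: "'q \<times> 'q"
    using that norm_snd_le_norm[of x] by linarith
  have vel_lip: "norm (vel g t x - vel g t y) \<le> \<Lambda> * norm (x - y)"
    if g: "force g" and x: "norm x \<le> N" and y: "norm y \<le> N" for g t x y
  proof -
    let ?s = "snd x - snd y"
    have "norm (vel g t x - vel g t y) \<le>
        norm (- (g t (snd x) - g t (snd y)) - (\<psi> (snd x) - \<psi> (snd y))) + norm (fst x - fst y)"
      using norm_Pair_le[of "- (g t (snd x) - g t (snd y)) - (\<psi> (snd x) - \<psi> (snd y))" "fst x - fst y"]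
      by (simp add: vel_def algebra_simps)
    also have "\<dots> \<le> norm (g t (snd x) - g t (snd y)) + norm (\<psi> (snd x) - \<psi> (snd y)) + norm (fst x - fst y)"
      using norm_triangle_ineq4[of "- (g t (snd x) - g t (snd y))" "\<psi> (snd x) - \<psi> (snd y)"]
      by (simp add: norm_minus_commute)
    also have "\<dots> \<le> L * norm ?s + \<bar>B\<bar> * norm ?s + norm (fst x - fst y)"
    proof -
      have "norm (g t (snd x) - g t (snd y)) \<le> L * norm ?s" using g by (simp add: force_def)
      moreover have "norm (\<psi> (snd x) - \<psi> (snd y)) \<le> \<bar>B\<bar> * norm ?s"
        using B[OF snd_le[OF x] snd_le[OF y]] mult_right_mono[OF abs_ge_self norm_ge_zero, of B ?s]
        by linarith
      ultimately show ?thesis by simp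
    qed
    also have "\<dots> \<le> L * norm (x - y) + \<bar>B\<bar> * norm (x - y) + norm (x - y)"
      using norm_snd_le_norm[of "x - y"] norm_fst_le_norm[of "x - y"] L_nonneg
      by (intro add_mono mult_left_mono) auto
    finally show ?thesis by (simp add: \<Lambda>_def algebra_simps)
  qed
  have vel_bound: "norm (vel g t x) \<le> V" if g: "force g" and x: "norm x \<le> N" for g t x
  proof -
    have "norm (\<psi> (snd x) - \<psi> 0) \<le> \<bar>B\<bar> * norm (snd x)"
      using B[OF snd_le[OF x], of 0] mult_right_mono[OF abs_ge_self norm_ge_zero, of B "snd x"]
      by simp
    also have "\<dots> \<le> \<bar>B\<bar> * N" using snd_le[OF x] by (intro mult_left_mono) auto
    finally have "norm (\<psi> (snd x)) \<le> norm (\<psi> 0) + \<bar>B\<bar> * N"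
      using norm_triangle_ineq2[of "\<psi> (snd x)" "\<psi> 0"] by linarith
    moreover have "norm (g t (snd x)) \<le> C" using g by (simp add: force_def)
    moreover have "norm (vel g t x) \<le> norm (g t (snd x) + \<psi> (snd x)) + norm (fst x)"
      using norm_Pair_le[of "- (g t (snd x) + \<psi> (snd x))" "fst x"] by (simp only: vel_def norm_minus_cancel)
    moreover have "norm (fst x) \<le> N" using norm_fst_le_norm[of x] x by linarith
    ultimately show ?thesis
      unfolding V_def using norm_triangle_ineq[of "g t (snd x)" "\<psi> (snd x)"] by linarith
  qed
  show thesis
  \<comment> \<open>The factor 2 pays for the length coordinate: the speed obeys the same bound and
    the same Lipschitz constant as the velocity.\<close>
  proof (rule that[of "2 * \<Lambda>" "2 * V"])
    show "0 \<le> 2 * \<Lambda>" using L_nonneg by (simp add: \<Lambda>_def)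
    show "0 \<le> 2 * V" using C_nonneg by (simp add: V_def)
    fix g t and z w :: "('q \<times> 'q) \<times> real" assume g: "force g"
    show "norm (field g N t z) \<le> 2 * V"
      using vel_bound[OF g norm_trunc, of t "fst z"]
        norm_Pair_le[of "vel g t (trunc N (fst z))" "norm (vel g t (trunc N (fst z)))"]
      by (simp add: field_def)
    let ?v = "vel g t (trunc N (fst z))" and ?w = "vel g t (trunc N (fst w))"
    have "norm (field g N t z - field g N t w) \<le> norm (?v - ?w) + \<bar>norm ?v - norm ?w\<bar>"
      using norm_Pair_le[of "?v - ?w" "norm ?v - norm ?w"] by (simp add: field_def)
    also have "\<dots> \<le> 2 * norm (?v - ?w)" using norm_triangle_ineq3[of ?v ?w] by simp
    also have "norm (?v - ?w) \<le> \<Lambda> * norm (trunc N (fst z) - trunc N (fst w))"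
      by (intro vel_lip g norm_trunc)
    also have "norm (trunc N (fst z) - trunc N (fst w)) \<le> norm (z - w)"
      using trunc_lip[of N "fst z" "fst w"] norm_fst_le_norm[of "z - w"] by simp
    finally have "norm (field g N t z - field g N t w) \<le> 2 * (\<Lambda> * norm (z - w))"
      using L_nonneg by (simp add: \<Lambda>_def mult_left_mono)
    then show "norm (field g N t z - field g N t w) \<le> 2 * \<Lambda> * norm (z - w)"
      by (simp add: mult.assoc)
  qed
qed

lemma psi_continuous: "continuous_on UNIV \<psi>"
  unfolding continuous_on_eq_continuous_at[OF open_UNIV]
proof
  fix q :: 'q
  obtain B where B: "\<And>x y. norm x \<le> norm q + 1 \<Longrightarrow> norm y \<le> norm q + 1 \<Longrightarrow> norm (\<psi> x - \<psi> y) \<le> B * norm (x - y)"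
    using psi_lip[of "norm q + 1"] unfolding Ball_def mem_cball_0 by metis
  have "\<bar>B\<bar>-lipschitz_on (cball 0 (norm q + 1)) \<psi>"
    using B mult_right_mono[OF abs_ge_self norm_ge_zero, of B]
    by (intro lipschitz_onI) (auto simp: dist_norm intro: order_trans)
  then have "continuous_on (ball 0 (norm q + 1)) \<psi>"
    by (intro continuous_on_subset[OF lipschitz_on_continuous_on]) auto
  then show "isCont \<psi> q"
    by (simp add: continuous_on_eq_continuous_at)
qed

lemma vel_continuous:
  assumes "force g"
  shows "continuous_on UNIV (\<lambda>(t, x). vel g t x)"
proof -
  have g: "continuous_on UNIV (\<lambda>(t, q). g t q)" using assms by (simp add: force_def)
  show ?thesis
    unfolding vel_def split_def
    by (intro continuous_intros continuous_on_compose2[OF psi_continuous]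
        continuous_on_compose2[OF g, of _ "\<lambda>z. (fst z, snd (snd z))", simplified]) auto
qed

lemma field_continuous:
  assumes "force g"
  shows "continuous_on UNIV (\<lambda>(t, z). field g N t z)"
proof -
  have t: "continuous_on UNIV (trunc N)"
    unfolding trunc_def by (rule continuous_on_closest_point) auto
  have "continuous_on UNIV (\<lambda>y. vel g (fst y) (trunc N (fst (snd y))))"
    for y :: "real \<times> ('q \<times> 'q) \<times> real"
    by (rule continuous_on_compose2[OF vel_continuous[OF assms], of _ "\<lambda>y. (fst y, trunc N (fst (snd y)))", simplified])
       (intro continuous_intros continuous_on_compose2[OF t], auto)
  then show ?thesis
    unfolding field_def split_def by (intro continuous_intros) auto
qed

section \<open>Trajectories of the truncated system and their stability\<close>

definition Z :: "(real \<Rightarrow> 'q \<Rightarrow> 'q) \<Rightarrow> nat \<Rightarrow> 'q \<times> 'q \<Rightarrow> real \<Rightarrow> ('q \<times> 'q) \<times> real" where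
  "Z g N x = (SOME Z. ode_sol (field g N) (x, 0) Z)"

text \<open>Freezing negative times at the initial point gives a continuous function on the whole
  line, which can also be evaluated at a delayed time before 0.\<close>

definition pos :: "(real \<Rightarrow> 'q \<Rightarrow> 'q) \<Rightarrow> nat \<Rightarrow> real \<Rightarrow> 'q \<times> 'q \<Rightarrow> 'q \<times> 'q" where
  "pos g N t x = fst (Z g N x (max 0 t))"

definition len :: "(real \<Rightarrow> 'q \<Rightarrow> 'q) \<Rightarrow> nat \<Rightarrow> real \<Rightarrow> 'q \<times> 'q \<Rightarrow> real" where
  "len g N t x = snd (Z g N x (max 0 t))"

definition wt :: "(real \<Rightarrow> 'q \<Rightarrow> 'q) \<Rightarrow> nat \<Rightarrow> real \<Rightarrow> 'q \<times> 'q \<Rightarrow> real" where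
  "wt g N t x = exp (- (\<epsilon> * len g N t x))"

lemma Z_sol:
  assumes "force g"
  shows "ode_sol (field g N) (x, 0) (Z g N x)"
proof -
  obtain \<Lambda> V where "\<And>t z. norm (field g N t z) \<le> V"
    "\<And>t z w. norm (field g N t z - field g N t w) \<le> \<Lambda> * norm (z - w)"
    by (rule field_bounds[of N]) (use assms in blast)
  then have "\<exists>Z. ode_sol (field g N) (x, 0) Z"
    by (rule ode_sol_exists[OF field_continuous[OF assms]])
  then show ?thesis unfolding Z_def by (rule someI_ex)
qed

lemma len_0 [simp]: "force g \<Longrightarrow> len g N 0 x = 0"
  and pos_0 [simp]: "force g \<Longrightarrow> pos g N 0 x = x"
  using Z_sol[of g N x] by (auto simp: len_def pos_def ode_sol_def)

lemma pos_deriv: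
  assumes "force g" "t > 0"
  shows "((\<lambda>t. pos g N t x) has_vector_derivative vel g t (trunc N (pos g N t x))) (at t)"
    and "((\<lambda>t. len g N t x) has_vector_derivative norm (vel g t (trunc N (pos g N t x)))) (at t)"
proof -
  have Z: "(Z g N x has_vector_derivative field g N t (Z g N x t)) (at t)"
    by (rule ode_sol_at[OF Z_sol]) fact+
  have "((\<lambda>t. fst (Z g N x t)) has_vector_derivative fst (field g N t (Z g N x t))) (at t)"
    using Z has_derivative_fst unfolding has_vector_derivative_def by fastforce
  then show "((\<lambda>t. pos g N t x) has_vector_derivative vel g t (trunc N (pos g N t x))) (at t)"
    using has_vector_derivative_transform_within_open[of _ _ t "{0<..}" "\<lambda>t. pos g N t x"] assms
    by (auto simp: pos_def field_def)
  have "((\<lambda>t. snd (Z g N x t)) has_vector_derivative snd (field g N t (Z g N x t))) (at t)"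
    using Z has_derivative_snd unfolding has_vector_derivative_def by fastforce
  then show "((\<lambda>t. len g N t x) has_vector_derivative norm (vel g t (trunc N (pos g N t x)))) (at t)"
    using has_vector_derivative_transform_within_open[of _ _ t "{0<..}" "\<lambda>t. len g N t x"] assms
    by (auto simp: len_def pos_def field_def)
qed

lemma pos_len_continuous_time:
  assumes "force g"
  shows "continuous_on UNIV (\<lambda>t. pos g N t x)" "continuous_on UNIV (\<lambda>t. len g N t x)"
proof -
  have "continuous_on UNIV (\<lambda>t. Z g N x (max 0 t))"
    by (rule continuous_on_compose2[OF ode_sol_continuous[OF Z_sol[OF assms]]])
       (auto intro!: continuous_intros)
  then show "continuous_on UNIV (\<lambda>t. pos g N t x)" "continuous_on UNIV (\<lambda>t. len g N t x)"
    unfolding pos_def len_def by (auto intro!: continuous_intros)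
qed

lemma pos_dist_le_len:
  assumes g: "force g" and "0 \<le> s" "s \<le> t"
  shows "norm (pos g N t x - pos g N s x) \<le> len g N t x - len g N s x"
proof (cases "s = t")
  case False
  show ?thesis
  proof (rule differentiable_bound_general)
    show "continuous_on {s..t} (\<lambda>t. pos g N t x)" "continuous_on {s..t} (\<lambda>t. len g N t x)"
      by (rule continuous_on_subset[OF pos_len_continuous_time(1)[OF g] subset_UNIV],
          rule continuous_on_subset[OF pos_len_continuous_time(2)[OF g] subset_UNIV])
    fix r assume "s < r" "r < t"
    then have r: "0 < r" using assms by simp
    show "((\<lambda>t. pos g N t x) has_vector_derivative vel g r (trunc N (pos g N r x))) (at r)"
      "((\<lambda>t. len g N t x) has_vector_derivative norm (vel g r (trunc N (pos g N r x)))) (at r)"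
      by (fact pos_deriv[OF g r])+
  qed (use False assms in auto)
qed simp

lemma len_mono: "force g \<Longrightarrow> 0 \<le> s \<Longrightarrow> s \<le> t \<Longrightarrow> len g N s x \<le> len g N t x"
  using pos_dist_le_len[of g s t N x] norm_ge_zero[of "pos g N t x - pos g N s x"] by linarith

lemma len_nonneg: "force g \<Longrightarrow> 0 \<le> len g N t x"
proof -
  have "len g N t x = len g N (max 0 t) x" by (simp add: len_def)
  then show "force g \<Longrightarrow> ?thesis" using len_mono[of g 0 "max 0 t" N x] by simp
qed

lemma norm_pos_le:
  assumes "force g" "0 \<le> t"
  shows "norm (pos g N t x) \<le> norm x + len g N t x"
  using pos_dist_le_len[OF assms(1) order_refl assms(2), of N x] assms
    norm_triangle_ineq2[of "pos g N t x" x] by simp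

lemma wt_bounds: "force g \<Longrightarrow> 0 < wt g N t x" "force g \<Longrightarrow> wt g N t x \<le> 1"
  using len_nonneg[of g N t x] eps by (auto simp: wt_def)

lemma Z_stable_initial:
  obtains \<Lambda> where "\<And>g t x y. force g \<Longrightarrow> 0 \<le> t \<Longrightarrow>
    norm (Z g N x t - Z g N y t) \<le> norm (x - y) * exp (\<Lambda> * t)"
proof -
  obtain \<Lambda> V where L: "\<And>g t z w. force g \<Longrightarrow> norm (field g N t z - field g N t w) \<le> \<Lambda> * norm (z - w)"
    by (rule field_bounds[of N]) blast
  show thesis
  \<comment> \<open>The exponent is halved because \<open>ode_stability\<close> bounds the square of
    the distance.\<close>
  proof (rule that[of "(2 * \<bar>\<Lambda>\<bar> + 1) / 2"])
    fix g and t :: real and x y assume g: "force g" and t: "0 \<le> t"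
    have "(norm (Z g N x t - Z g N y t))\<^sup>2 \<le>
        ((norm ((x, 0::real) - (y, 0)))\<^sup>2 + 0\<^sup>2 * t) * exp ((2 * \<bar>\<Lambda>\<bar> + 1) * t)"
      by (rule ode_stability[OF Z_sol[OF g] Z_sol[OF g] t]) (simp add: L[OF g])
    also have "\<dots> = (norm (x - y) * exp ((2 * \<bar>\<Lambda>\<bar> + 1) / 2 * t))\<^sup>2"
      by (simp add: power_mult_distrib norm_Pair flip: exp_of_nat_mult)
    finally show "norm (Z g N x t - Z g N y t) \<le> norm (x - y) * exp ((2 * \<bar>\<Lambda>\<bar> + 1) / 2 * t)"
      by (rule power2_le_imp_le) simp
  qed
qed

text \<open>A truncated trajectory reads the force only on the ball of radius \<open>N\<close> and
  before the final time. The first restriction makes locally uniform convergence of forces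
  sufficient; the second, with \<open>\<delta> = 0\<close>, gives causality.\<close>

lemma Z_stable_force:
  assumes T: "0 \<le> T"
  obtains c where "0 \<le> c" "\<And>g h \<delta> x. force g \<Longrightarrow> force h \<Longrightarrow> 0 \<le> \<delta> \<Longrightarrow>
    (\<And>t q. 0 < t \<Longrightarrow> t < T \<Longrightarrow> norm q \<le> N \<Longrightarrow> norm (g t q - h t q) \<le> \<delta>) \<Longrightarrow>
    norm (Z g N x T - Z h N x T) \<le> c * \<delta>"
proof -
  obtain \<Lambda> V where L: "\<And>g t z w. force g \<Longrightarrow> norm (field g N t z - field g N t w) \<le> \<Lambda> * norm (z - w)"
    by (rule field_bounds[of N]) blast
  \<comment> \<open>Square root of the bound in \<open>ode_stability\<close> for equal initial
    points and inhomogeneity \<open>2 * \<delta>\<close>; the 2 arises because the velocity and its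
    norm each change by at most \<open>\<delta>\<close>.\<close>
  define c where "c = sqrt (4 * T * exp ((2 * \<bar>\<Lambda>\<bar> + 1) * T))"
  show thesis
  proof (rule that[of c])
    show "0 \<le> c" using T by (simp add: c_def)
    fix g h \<delta> x
    assume g: "force g" and h: "force h" and \<delta>: "0 \<le> \<delta>"
      and le: "\<And>t q. 0 < t \<Longrightarrow> t < T \<Longrightarrow> norm q \<le> N \<Longrightarrow> norm (g t q - h t q) \<le> \<delta>"
    have "norm (field g N t (Z g N x t) - field h N t (Z h N x t))
        \<le> \<Lambda> * norm (Z g N x t - Z h N x t) + 2 * \<delta>" if t: "0 < t" "t < T" for t
    proof -
      let ?y = "trunc N (fst (Z h N x t))"
      have "norm (snd ?y) \<le> N" using norm_trunc[of N "fst (Z h N x t)"] norm_snd_le_norm[of ?y] by linarith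
      then have "norm (g t (snd ?y) - h t (snd ?y)) \<le> \<delta>" by (rule le[OF t])
      moreover have "norm (vel g t ?y - vel h t ?y) = norm (g t (snd ?y) - h t (snd ?y))"
        by (simp add: vel_def norm_Pair norm_minus_commute)
      ultimately have v: "norm (vel g t ?y - vel h t ?y) \<le> \<delta>" by simp
      have "norm (field g N t (Z h N x t) - field h N t (Z h N x t))
          \<le> norm (vel g t ?y - vel h t ?y) + \<bar>norm (vel g t ?y) - norm (vel h t ?y)\<bar>"
        using norm_Pair_le[of "vel g t ?y - vel h t ?y" "norm (vel g t ?y) - norm (vel h t ?y)"]
        by (simp add: field_def)
      also have "\<dots> \<le> 2 * \<delta>"
        using v norm_triangle_ineq3[of "vel g t ?y" "vel h t ?y"] by linarith
      finally show ?thesis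
        using L[OF g, of t "Z g N x t" "Z h N x t"]
          norm_triangle_ineq[of "field g N t (Z g N x t) - field g N t (Z h N x t)"
            "field g N t (Z h N x t) - field h N t (Z h N x t)"] by simp
    qed
    then have "(norm (Z g N x T - Z h N x T))\<^sup>2 \<le>
        ((norm ((x, 0::real) - (x, 0)))\<^sup>2 + (2 * \<delta>)\<^sup>2 * T) * exp ((2 * \<bar>\<Lambda>\<bar> + 1) * T)"
      by (rule ode_stability[OF Z_sol[OF g] Z_sol[OF h] T])
    also have "\<dots> = (c * \<delta>)\<^sup>2"
      using T by (simp add: c_def power_mult_distrib power2_eq_square)
    finally show "norm (Z g N x T - Z h N x T) \<le> c * \<delta>"
      by (rule power2_le_imp_le) (use T \<delta> in \<open>auto simp: c_def\<close>)
  qed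
qed

lemma Z_lipschitz_time:
  obtains V where "0 \<le> V" "\<And>g s t x. force g \<Longrightarrow>
    norm (Z g N x (max 0 t) - Z g N x (max 0 s)) \<le> V * \<bar>t - s\<bar>"
proof -
  obtain \<Lambda> V where V: "0 \<le> V" "\<And>g t z. force g \<Longrightarrow> norm (field g N t z) \<le> V"
    by (rule field_bounds[of N]) blast
  show thesis
  proof (rule that[OF V(1)])
    fix g and s t :: real and x assume g: "force g"
    have "norm (Z g N x (max 0 t) - Z g N x (max 0 s)) \<le> V * \<bar>max 0 t - max 0 s\<bar>"
      by (rule ode_sol_bound[OF Z_sol[OF g]]) (auto simp: V g)
    also have "\<dots> \<le> V * \<bar>t - s\<bar>" using V by (intro mult_left_mono) auto
    finally show "norm (Z g N x (max 0 t) - Z g N x (max 0 s)) \<le> V * \<bar>t - s\<bar>" .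
  qed
qed

lemma Z_continuous:
  assumes g: "force g"
  shows "continuous_on UNIV (\<lambda>(t, x). Z g N x (max 0 t))"
proof -
  obtain V where V: "\<And>s t x. norm (Z g N x (max 0 t) - Z g N x (max 0 s)) \<le> V * \<bar>t - s\<bar>"
    using Z_lipschitz_time g by metis
  obtain \<Lambda> where \<Lambda>: "\<And>t x y. 0 \<le> t \<Longrightarrow> norm (Z g N x t - Z g N y t) \<le> norm (x - y) * exp (\<Lambda> * t)"
    using Z_stable_initial g by metis
  have "isCont (\<lambda>z. Z g N (snd z) (max 0 (fst z))) (t, x)" for t x
    unfolding isCont_def fst_conv snd_conv
  proof (rule LIM_zero_cancel, rule Lim_null_comparison[OF always_eventually], intro allI)
    show "((\<lambda>z. norm (snd z - x) * exp (\<Lambda> * max 0 (fst z)) + V * \<bar>fst z - t\<bar>) \<longlongrightarrow> 0) (at (t, x))"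
      by (rule tendsto_eq_rhs, (rule tendsto_intros)+) simp
    fix z
    show "norm (Z g N (snd z) (max 0 (fst z)) - Z g N x (max 0 t))
        \<le> norm (snd z - x) * exp (\<Lambda> * max 0 (fst z)) + V * \<bar>fst z - t\<bar>"
      using V[of x "fst z" t] \<Lambda>[of "max 0 (fst z)" "snd z" x]
        norm_triangle_ineq[of "Z g N (snd z) (max 0 (fst z)) - Z g N x (max 0 (fst z))"
          "Z g N x (max 0 (fst z)) - Z g N x (max 0 t)"] by simp
  qed
  then show ?thesis
    by (auto simp: continuous_on_eq_continuous_at split_def)
qed

lemma Z_measurable [measurable]:
  assumes "force g"
  shows "(\<lambda>(t, x). pos g N t x) \<in> borel_measurable borel"
    "(\<lambda>(t, x). len g N t x) \<in> borel_measurable borel"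
    "(\<lambda>(t, x). wt g N t x) \<in> borel_measurable borel"
  unfolding pos_def len_def wt_def split_def
  by (intro borel_measurable_continuous_onI continuous_intros
      Z_continuous[OF assms, unfolded split_def])+

text \<open>As long as its length does not exceed \<open>N - \<parallel>x\<parallel>\<close>, a trajectory started at \<open>x\<close> stays in the
  ball on which all truncations from the \<open>N\<close>-th on agree.\<close>

lemma Z_agree:
  assumes g: "force g" and "N \<le> M" and t: "0 \<le> t"
    and alive: "norm x + len g N t x \<le> N \<or> norm x + len g M t x \<le> N"
  shows "Z g N x t = Z g M x t"
proof -
  \<comment> \<open>Here \<open>n\<close> is the level at which the length is known to be small. Its
    trajectory stays in the ball of radius \<open>N\<close>, hence in both truncation balls, so the
    two fields agree along it and stability with zero inhomogeneity forces equality.\<close>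
  obtain n m where nm: "{n, m} = {N, M}" and n: "norm x + len g n t x \<le> N"
    using alive by blast
  obtain \<Lambda> V where L: "\<And>t z w. norm (field g m t z - field g m t w) \<le> \<Lambda> * norm (z - w)"
    by (rule field_bounds[of m]) (use g in blast)
  have "(norm (Z g n x t - Z g m x t))\<^sup>2 \<le>
      ((norm ((x, 0::real) - (x, 0)))\<^sup>2 + 0\<^sup>2 * t) * exp ((2 * \<bar>\<Lambda>\<bar> + 1) * t)"
  proof (rule ode_stability[OF Z_sol[OF g] Z_sol[OF g] t])
    fix s assume s: "0 < s" "s < t"
    have "norm (pos g n s x) \<le> N"
      using norm_pos_le[OF g, of s n x] len_mono[OF g, of s t n x] s n by linarith
    then have y: "norm (fst (Z g n x s)) \<le> N" using s by (simp add: pos_def)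
    have "norm (fst (Z g n x s)) \<le> n" "norm (fst (Z g n x s)) \<le> m"
      using y nm \<open>N \<le> M\<close> by (auto simp: doubleton_eq_iff)
    then have "field g n s (Z g n x s) = field g m s (Z g n x s)"
      by (simp add: field_def trunc_id)
    then show "norm (field g n s (Z g n x s) - field g m s (Z g m x s))
        \<le> \<Lambda> * norm (Z g n x s - Z g m x s) + 0"
      using L by simp
  qed
  then have "Z g n x t = Z g m x t" by simp
  then show ?thesis using nm by (auto simp: doubleton_eq_iff)
qed

text \<open>Because either level may certify the bound, being short at level \<open>N\<close> and
  being short at a higher level are equivalent. The direction from \<open>M\<close> down to
  \<open>N\<close> is the one behind \<open>wt_dead\<close>.\<close>

lemma pos_len_agree:
  assumes "force g" "N \<le> M" "norm x + len g N t x \<le> N \<or> norm x + len g M t x \<le> N"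
  shows "pos g M t x = pos g N t x" "len g M t x = len g N t x" "wt g M t x = wt g N t x"
proof -
  have "len g n (max 0 t) x = len g n t x" for n by (simp add: len_def)
  then have "Z g N x (max 0 t) = Z g M x (max 0 t)"
    using Z_agree[of g N M "max 0 t" x] assms by simp
  then show "pos g M t x = pos g N t x" "len g M t x = len g N t x" "wt g M t x = wt g N t x"
    by (simp_all add: pos_def len_def wt_def)
qed

section \<open>Removing the truncation\<close>

definition flow :: "(real \<Rightarrow> 'q \<Rightarrow> 'q) \<Rightarrow> real \<Rightarrow> 'q \<times> 'q \<Rightarrow> 'q \<times> 'q" where
  "flow g t x = lim (\<lambda>N. pos g N t x)"

text \<open>If a trajectory exceeds the length bound at every level, the limit defining
  \<open>flow\<close> need not exist and its value is arbitrary. The weights then tend to 0, and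
  \<open>flow\<close> is only ever used together with the factor \<open>mass\<close>.\<close>

definition mass :: "(real \<Rightarrow> 'q \<Rightarrow> 'q) \<Rightarrow> real \<Rightarrow> 'q \<times> 'q \<Rightarrow> real" where
  "mass g t x = lim (\<lambda>N. wt g N t x)"

text \<open>Bounds the weight left to a trajectory from \<open>x\<close> that is longer than
  \<open>N - norm x\<close>. It involves neither the force nor the time; the minimum with 1 covers
  starting points outside the ball.\<close>

definition tail :: "nat \<Rightarrow> 'q \<times> 'q \<Rightarrow> real" where
  "tail N x = min 1 (exp (- (\<epsilon> * (N - norm x))))"

lemma tail_bounds: "0 \<le> tail N x" "tail N x \<le> 1"
  by (auto simp: tail_def)

lemma tail_tendsto: "(\<lambda>N. tail N x) \<longlonglongrightarrow> 0"
proof -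
  have "filterlim (\<lambda>N. - norm x + real N) at_top sequentially"
    by (rule filterlim_tendsto_add_at_top[OF tendsto_const filterlim_real_sequentially])
  then have "filterlim (\<lambda>N. \<epsilon> * (real N - norm x)) at_top sequentially"
    by (intro filterlim_tendsto_pos_mult_at_top[OF tendsto_const eps]) simp
  then have "((\<lambda>N. exp (- (\<epsilon> * (real N - norm x)))) \<longlongrightarrow> 0) sequentially"
    by (intro filterlim_compose[OF exp_at_bot] filterlim_uminus_at_top[THEN iffD1])
  then show ?thesis
    unfolding tail_def by (rule tendsto_eq_rhs[OF tendsto_min[OF tendsto_const]]) simp
qed

lemma flow_alive:
  assumes "force g" "norm x + len g N t x \<le> N"
  shows "flow g t x = pos g N t x" "mass g t x = wt g N t x"
proof -
  have "(\<lambda>N. pos g N t x) \<longlonglongrightarrow> pos g N t x" "(\<lambda>N. wt g N t x) \<longlonglongrightarrow> wt g N t x"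
    by (rule tendsto_eventually, rule eventually_sequentiallyI[of N], simp add: pos_len_agree[OF assms(1)] assms(2))+
  then show "flow g t x = pos g N t x" "mass g t x = wt g N t x"
    by (auto simp: flow_def mass_def intro: limI)
qed

text \<open>A trajectory past the bound at level \<open>N\<close> is past it at every higher level
  too, since otherwise the two levels would agree. Its length there still exceeds
  \<open>N - norm x\<close>.\<close>

lemma wt_dead:
  assumes "force g" "N \<le> M" "N < norm x + len g N t x"
  shows "wt g M t x \<le> tail N x"
proof -
  have "N < norm x + len g M t x"
    using pos_len_agree(2)[OF assms(1,2), of x t] assms by linarith
  then have "\<epsilon> * (N - norm x) \<le> \<epsilon> * len g M t x"
    using eps by (intro mult_left_mono) auto
  then show ?thesis
    using wt_bounds(2)[OF assms(1), of M t x] by (simp add: tail_def wt_def)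
qed

lemma wt_tendsto_mass:
  assumes g: "force g"
  shows "(\<lambda>N. wt g N t x) \<longlonglongrightarrow> mass g t x"
proof (cases "\<exists>N::nat. norm x + len g N t x \<le> N")
  case True
  then obtain N :: nat where N: "norm x + len g N t x \<le> N" by blast
  have "eventually (\<lambda>M. wt g M t x = mass g t x) sequentially"
    by (rule eventually_sequentiallyI[of N])
       (simp add: pos_len_agree[OF g] flow_alive[OF g N] N)
  then show ?thesis by (rule tendsto_eventually)
next
  case False
  then have "wt g N t x \<le> tail N x" for N
    by (intro wt_dead g) (auto simp: not_le)
  then have "(\<lambda>N. wt g N t x) \<longlonglongrightarrow> 0"
    using less_imp_le[OF wt_bounds(1)[OF g, of _ t x]]
    by (intro tendsto_sandwich[OF _ _ tendsto_const tail_tendsto[of x]] always_eventually allI) auto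
  then show ?thesis by (simp add: mass_def limI)
qed

lemma mass_bounds:
  assumes "force g"
  shows "0 \<le> mass g t x" "mass g t x \<le> 1"
  using LIMSEQ_le_const[OF wt_tendsto_mass[OF assms], of 0 t x]
    LIMSEQ_le_const2[OF wt_tendsto_mass[OF assms], of t x 1] wt_bounds[OF assms, of _ t x]
  by (auto intro: less_imp_le)

lemma flow_dead:
  assumes "force g" "N < norm x + len g N t x"
  shows "mass g t x \<le> tail N x"
  by (rule LIMSEQ_le_const2[OF wt_tendsto_mass[OF assms(1)]])
     (use wt_dead[OF assms(1) _ assms(2)] in blast)

text \<open>Either the truncated and the true trajectory coincide, or both weights are below
  \<open>tail N x\<close>. Since the bound is uniform in \<open>g\<close> and \<open>t\<close>,
  limits in \<open>N\<close> can be interchanged with limits in the force and in time.\<close>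

lemma flow_approx:
  fixes f :: "'q \<times> 'q \<Rightarrow> 'b::real_normed_vector"
  assumes g: "force g" and f: "\<And>x. norm (f x) \<le> B"
  shows "norm (mass g t x *\<^sub>R f (flow g t x) - wt g N t x *\<^sub>R f (pos g N t x)) \<le> 2 * B * tail N x"
proof (cases "norm x + len g N t x \<le> N")
  case True
  have "0 \<le> B" using norm_ge_zero f by (rule order_trans)
  then show ?thesis using flow_alive[OF g True] tail_bounds by simp
next
  case False
  then have "mass g t x * norm (f (flow g t x)) \<le> tail N x * B"
    by (intro mult_mono flow_dead f g) (auto simp: tail_bounds)
  moreover have "wt g N t x * norm (f (pos g N t x)) \<le> tail N x * B"
    using False by (intro mult_mono wt_dead f g) (auto simp: tail_bounds)
  ultimately show ?thesis
    using norm_triangle_ineq4[of "mass g t x *\<^sub>R f (flow g t x)" "wt g N t x *\<^sub>R f (pos g N t x)"]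
      wt_bounds[OF g, of N t x] mass_bounds[OF g, of t x] by (simp add: mult_ac)
qed

lemma flow_tendsto:
  fixes f :: "'q \<times> 'q \<Rightarrow> 'b::real_normed_vector"
  assumes "force g" "\<And>x. norm (f x) \<le> B"
  shows "(\<lambda>N. wt g N t x *\<^sub>R f (pos g N t x)) \<longlonglongrightarrow> mass g t x *\<^sub>R f (flow g t x)"
proof (rule LIM_zero_cancel, rule Lim_null_comparison[OF always_eventually], intro allI)
  show "(\<lambda>N. 2 * B * tail N x) \<longlonglongrightarrow> 0"
    using tendsto_mult_left[OF tail_tendsto[of x]] by fastforce
  show "norm (wt g N t x *\<^sub>R f (pos g N t x) - mass g t x *\<^sub>R f (flow g t x)) \<le> 2 * B * tail N x" for N
    using flow_approx[OF assms, where N = N] by (simp add: norm_minus_commute)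
qed

lemma flow_measurable:
  assumes "force g"
  shows "(\<lambda>(t, x). flow g t x) \<in> borel_measurable borel"
    "(\<lambda>(t, x). mass g t x) \<in> borel_measurable borel"
  unfolding flow_def mass_def split_def
  by (rule borel_measurable_lim_metric, use Z_measurable[OF assms] in \<open>simp add: split_def\<close>)+

lemma flow_measurable' [measurable]:
  assumes "force g"
  shows "flow g t \<in> borel_measurable borel" "mass g t \<in> borel_measurable borel"
    "pos g N t \<in> borel_measurable borel" "wt g N t \<in> borel_measurable borel"
proof -
  have "(\<lambda>x :: 'q \<times> 'q. (t, x)) \<in> borel_measurable borel"
    by (intro borel_measurable_continuous_onI continuous_intros)
  note this[THEN measurable_compose]
  from this[OF flow_measurable(1)[OF assms]] this[OF flow_measurable(2)[OF assms]]
    this[OF Z_measurable(1)[OF assms]] this[OF Z_measurable(3)[OF assms]]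
  show "flow g t \<in> borel_measurable borel" "mass g t \<in> borel_measurable borel"
    "pos g N t \<in> borel_measurable borel" "wt g N t \<in> borel_measurable borel"
    by simp_all
qed

section \<open>Averages over the initial measure and the generated force\<close>

lemma integrable_bounded:
  fixes f :: "'q \<times> 'q \<Rightarrow> 'b::{banach, second_countable_topology}"
  assumes "f \<in> borel_measurable borel" "\<And>x. norm (f x) \<le> B"
  shows "integrable \<mu>\<^sub>0 f"
  using assms by (intro integrable_const_bound[of _ B]) auto

lemma norm_integral_le:
  fixes f :: "'q \<times> 'q \<Rightarrow> 'b::{banach, second_countable_topology}"
  assumes "\<And>x. norm (f x) \<le> B"
  shows "norm (\<integral>x. f x \<partial>\<mu>\<^sub>0) \<le> B"
proof (cases "integrable \<mu>\<^sub>0 f")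
  case True
  have "norm (\<integral>x. f x \<partial>\<mu>\<^sub>0) \<le> (\<integral>x. norm (f x) \<partial>\<mu>\<^sub>0)" by simp
  also have "\<dots> \<le> (\<integral>x. B \<partial>\<mu>\<^sub>0)"
    using True assms by (intro integral_mono) auto
  finally show ?thesis by simp
next
  case False
  have "0 \<le> B" using norm_ge_zero assms by (rule order_trans)
  then show ?thesis by (simp add: not_integrable_integral_eq[OF False])
qed

definition Tail :: "nat \<Rightarrow> real" where
  "Tail N = (\<integral>x. tail N x \<partial>\<mu>\<^sub>0)"

lemma tail_measurable [measurable]: "tail N \<in> borel_measurable borel"
  unfolding tail_def by measurable

lemma Tail_tendsto: "Tail \<longlonglongrightarrow> 0"
proof -
  have "(\<lambda>N. \<integral>x. tail N x \<partial>\<mu>\<^sub>0) \<longlonglongrightarrow> (\<integral>x. 0 \<partial>\<mu>\<^sub>0)"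
    by (rule integral_dominated_convergence[where w = "\<lambda>_. 1"]) (auto simp: tail_bounds tail_tendsto)
  then show ?thesis by (simp add: Tail_def[abs_def])
qed

lemma integrable_flow:
  fixes f :: "'q \<times> 'q \<Rightarrow> 'b::{banach, second_countable_topology}"
  assumes g: "force g" and [measurable]: "f \<in> borel_measurable borel" and f: "\<And>x. norm (f x) \<le> B"
  shows "integrable \<mu>\<^sub>0 (\<lambda>x. mass g t x *\<^sub>R f (flow g t x))"
    "integrable \<mu>\<^sub>0 (\<lambda>x. wt g N t x *\<^sub>R f (pos g N t x))"
proof -
  have le: "norm (a *\<^sub>R f y) \<le> B" if "0 \<le> a" "a \<le> 1" for a y
    using mult_mono[OF that(2) f[of y]] that by simp
  note [measurable] = flow_measurable'[OF g]
  show "integrable \<mu>\<^sub>0 (\<lambda>x. mass g t x *\<^sub>R f (flow g t x))"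
    "integrable \<mu>\<^sub>0 (\<lambda>x. wt g N t x *\<^sub>R f (pos g N t x))"
    by (rule integrable_bounded[of _ B], measurable,
        use mass_bounds[OF g] wt_bounds[OF g] in \<open>blast intro: le less_imp_le\<close>)+
qed

lemma integral_flow_approx:
  fixes f :: "'q \<times> 'q \<Rightarrow> 'b::{banach, second_countable_topology}"
  assumes g: "force g" and [measurable]: "f \<in> borel_measurable borel" and f: "\<And>x. norm (f x) \<le> B"
  shows "norm ((\<integral>x. mass g t x *\<^sub>R f (flow g t x) \<partial>\<mu>\<^sub>0) - (\<integral>x. wt g N t x *\<^sub>R f (pos g N t x) \<partial>\<mu>\<^sub>0))
    \<le> 2 * B * Tail N"
proof -
  note int = integrable_flow[OF assms]
  have "norm ((\<integral>x. mass g t x *\<^sub>R f (flow g t x) \<partial>\<mu>\<^sub>0) - (\<integral>x. wt g N t x *\<^sub>R f (pos g N t x) \<partial>\<mu>\<^sub>0))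
      = norm (\<integral>x. mass g t x *\<^sub>R f (flow g t x) - wt g N t x *\<^sub>R f (pos g N t x) \<partial>\<mu>\<^sub>0)"
    by (simp add: int)
  also have "\<dots> \<le> (\<integral>x. norm (mass g t x *\<^sub>R f (flow g t x) - wt g N t x *\<^sub>R f (pos g N t x)) \<partial>\<mu>\<^sub>0)"
    by simp
  also have "\<dots> \<le> (\<integral>x. 2 * B * tail N x \<partial>\<mu>\<^sub>0)"
    by (intro integral_mono integrable_norm Bochner_Integration.integrable_diff int
        integrable_mult_right integrable_bounded[of _ 1] flow_approx[OF g f])
       (auto simp: tail_bounds)
  finally show ?thesis by (simp add: Tail_def)
qed

text \<open>The mean-field force of the transported measure, pulled back to initial points, so that
  its dependence on \<open>g\<close> goes through trajectories only. \<open>evolution_gforce\<close>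
  makes the identification.\<close>

definition gforce :: "(real \<Rightarrow> 'q \<Rightarrow> 'q) \<Rightarrow> real \<Rightarrow> 'q \<Rightarrow> 'q" where
  "gforce g t q = (\<integral>x. mass g t x *\<^sub>R K (q - snd (flow g t x)) \<partial>\<mu>\<^sub>0)"

lemma K_continuous: "continuous_on UNIV K"
proof (rule lipschitz_on_continuous_on)
  show "L-lipschitz_on UNIV K"
    by (rule lipschitz_onI[OF _ L_nonneg]) (simp add: dist_norm K_lip)
qed

lemma K_measurable [measurable]: "(\<lambda>x. K (q - snd x)) \<in> borel_measurable borel"
  by (intro borel_measurable_continuous_onI continuous_on_compose2[OF K_continuous] continuous_intros) auto

lemmas integrable_gforce = integrable_flow[OF _ K_measurable K_bound]

lemma norm_gforce_le: "force g \<Longrightarrow> norm (gforce g t q) \<le> C"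
proof -
  assume g: "force g"
  have "mass g t x * norm (K (q - snd (flow g t x))) \<le> 1 * C" for x
    by (intro mult_mono K_bound) (auto simp: mass_bounds[OF g])
  then show ?thesis unfolding gforce_def
    by (intro norm_integral_le) (simp add: mass_bounds[OF g])
qed

lemma gforce_lip: "force g \<Longrightarrow> norm (gforce g t q - gforce g t r) \<le> L * norm (q - r)"
proof -
  assume g: "force g"
  have "mass g t x * norm (K (q - snd (flow g t x)) - K (r - snd (flow g t x))) \<le> 1 * (L * norm (q - r))" for x
    by (intro mult_mono order_trans[OF K_lip]) (auto simp: mass_bounds[OF g] L_nonneg)
  then have "norm (\<integral>x. mass g t x *\<^sub>R (K (q - snd (flow g t x)) - K (r - snd (flow g t x))) \<partial>\<mu>\<^sub>0) \<le> L * norm (q - r)"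
    by (intro norm_integral_le) (simp add: mass_bounds[OF g])
  then show ?thesis
    unfolding gforce_def scaleR_diff_right
      Bochner_Integration.integral_diff[OF integrable_gforce(1)[OF g] integrable_gforce(1)[OF g]] .
qed

text \<open>The term \<open>L * D\<close> comes from moving the argument of \<open>K\<close>. The
  weight is \<epsilon>-Lipschitz in the length, as exp is 1-Lipschitz on nonpositive numbers, and
  this contributes \<open>\<epsilon> * D\<close> times the bound \<open>C\<close>. Letting force and
  time differ simultaneously covers both equicontinuity in time and continuity in the force.\<close>

lemma truncated_gforce_diff:
  assumes g: "force g" and h: "force h" and D: "\<And>x. norm (Z g N x (max 0 t) - Z h N x (max 0 s)) \<le> D"
  shows "norm ((\<integral>x. wt g N t x *\<^sub>R K (q - snd (pos g N t x)) \<partial>\<mu>\<^sub>0) -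
      (\<integral>x. wt h N s x *\<^sub>R K (q - snd (pos h N s x)) \<partial>\<mu>\<^sub>0)) \<le> (L + \<epsilon> * C) * D"
proof -
  have "norm (wt g N t x *\<^sub>R K (q - snd (pos g N t x)) - wt h N s x *\<^sub>R K (q - snd (pos h N s x)))
      \<le> (L + \<epsilon> * C) * D" for x
  proof -
    let ?a = "K (q - snd (pos g N t x))" and ?b = "K (q - snd (pos h N s x))"
    have "norm (?a - ?b) \<le> L * norm (snd (pos h N s x) - snd (pos g N t x))"
      using K_lip[of "q - snd (pos g N t x)" "q - snd (pos h N s x)"] by simp
    also have "norm (snd (pos h N s x) - snd (pos g N t x)) \<le> norm (pos g N t x - pos h N s x)"
      using norm_snd_le_norm[of "pos g N t x - pos h N s x"] by (simp add: norm_minus_commute)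
    also have "\<dots> \<le> D"
      using norm_fst_le_norm[of "Z g N x (max 0 t) - Z h N x (max 0 s)"] D[of x] by (simp add: pos_def)
    finally have K: "norm (?a - ?b) \<le> L * D" using L_nonneg by (simp add: mult_left_mono)
    have "\<bar>wt g N t x - wt h N s x\<bar> \<le> \<bar>- (\<epsilon> * len g N t x) - - (\<epsilon> * len h N s x)\<bar>"
      unfolding wt_def using eps len_nonneg[OF g] len_nonneg[OF h] by (intro abs_exp_diff_le) auto
    also have "\<dots> = \<bar>\<epsilon> * (len g N t x - len h N s x)\<bar>"
      by (simp add: algebra_simps abs_minus_commute)
    also have "\<dots> = \<epsilon> * \<bar>len g N t x - len h N s x\<bar>"
      using eps by (simp add: abs_mult)
    also have "\<dots> \<le> \<epsilon> * D"
      using norm_snd_le_norm[of "Z g N x (max 0 t) - Z h N x (max 0 s)"] D[of x] eps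
      by (intro mult_left_mono) (auto simp: len_def)
    finally have w: "\<bar>wt g N t x - wt h N s x\<bar> \<le> \<epsilon> * D" .
    have "wt g N t x *\<^sub>R ?a - wt h N s x *\<^sub>R ?b = wt g N t x *\<^sub>R (?a - ?b) + (wt g N t x - wt h N s x) *\<^sub>R ?b"
      by (simp only: scaleR_diff_right scaleR_diff_left) simp
    then have "norm (wt g N t x *\<^sub>R ?a - wt h N s x *\<^sub>R ?b)
        \<le> norm (wt g N t x *\<^sub>R (?a - ?b)) + norm ((wt g N t x - wt h N s x) *\<^sub>R ?b)"
      by (simp only: norm_triangle_ineq)
    also have "\<dots> = wt g N t x * norm (?a - ?b) + \<bar>wt g N t x - wt h N s x\<bar> * norm ?b"
      unfolding norm_scaleR abs_of_pos[OF wt_bounds(1)[OF g]] ..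
    also have "\<dots> \<le> 1 * (L * D) + (\<epsilon> * D) * C"
      by (rule add_mono[OF mult_mono[OF wt_bounds(2)[OF g] K] mult_mono[OF w K_bound]])
         (simp_all add: order_trans[OF abs_ge_zero w])
    also have "\<dots> = (L + \<epsilon> * C) * D" by (simp add: algebra_simps)
    finally show ?thesis .
  qed
  then have "norm (\<integral>x. wt g N t x *\<^sub>R K (q - snd (pos g N t x)) - wt h N s x *\<^sub>R K (q - snd (pos h N s x)) \<partial>\<mu>\<^sub>0)
      \<le> (L + \<epsilon> * C) * D"
    by (rule norm_integral_le)
  then show ?thesis
    unfolding Bochner_Integration.integral_diff[OF integrable_gforce(2)[OF g] integrable_gforce(2)[OF h]] .
qed

text \<open>Each passage to the \<open>N\<close>-th truncation costs \<open>2 * C * Tail N\<close>.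
  In applications \<open>N\<close> is fixed first, to make the tail term small; only then is
  \<open>D\<close> made small for this \<open>N\<close>.\<close>

lemma gforce_diff:
  assumes g: "force g" and h: "force h" and D: "\<And>x. norm (Z g N x (max 0 t) - Z h N x (max 0 s)) \<le> D"
  shows "norm (gforce g t q - gforce h s q) \<le> 4 * C * Tail N + (L + \<epsilon> * C) * D"
proof -
  let ?I = "\<lambda>g t. \<integral>x. wt g N t x *\<^sub>R K (q - snd (pos g N t x)) \<partial>\<mu>\<^sub>0"
  have "norm (gforce g t q - ?I g t) \<le> 2 * C * Tail N" "norm (gforce h s q - ?I h s) \<le> 2 * C * Tail N"
    unfolding gforce_def using integral_flow_approx[OF _ K_measurable K_bound] g h by auto
  moreover have "norm (?I g t - ?I h s) \<le> (L + \<epsilon> * C) * D"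
    by (rule truncated_gforce_diff[OF assms])
  ultimately show ?thesis
    using norm_diff_triangle_ineq[of "gforce g t q" "?I g t"]
      norm_triangle_ineq[of "gforce g t q - ?I g t" "?I g t - gforce h s q"]
      norm_triangle_ineq[of "?I g t - ?I h s" "?I h s - gforce h s q"]
      norm_minus_commute[of "gforce h s q" "?I h s"] by simp
qed

lemma Tail_small:
  assumes "0 < e"
  obtains N where "4 * C * Tail N < e"
proof -
  have "(\<lambda>N. 4 * C * Tail N) \<longlonglongrightarrow> 4 * C * 0" by (intro tendsto_intros Tail_tendsto)
  then have "eventually (\<lambda>N. 4 * C * Tail N < e) sequentially"
    using assms by (intro order_tendstoD) auto
  then show thesis using that by (auto simp: eventually_sequentially)
qed

lemma gforce_equicontinuous:
  assumes "0 < e"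
  obtains d where "0 < d"
    "\<And>g s t q. force g \<Longrightarrow> \<bar>t - s\<bar> < d \<Longrightarrow> norm (gforce g t q - gforce g s q) < e"
proof -
  obtain N where N: "4 * C * Tail N < e / 2" using Tail_small[of "e / 2"] assms by auto
  obtain V where V: "0 \<le> V" "\<And>g s t x. force g \<Longrightarrow>
      norm (Z g N x (max 0 t) - Z g N x (max 0 s)) \<le> V * \<bar>t - s\<bar>"
    by (rule Z_lipschitz_time[of N]) blast
  define A where "A = (L + \<epsilon> * C) * V"
  have A: "0 \<le> A" using L_nonneg C_nonneg V eps by (simp add: A_def)
  show thesis
  proof (rule that[of "e / (2 * (A + 1))"])
    show "0 < e / (2 * (A + 1))" using assms A by simp
    fix g and s t :: real and q assume g: "force g" and st: "\<bar>t - s\<bar> < e / (2 * (A + 1))"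
    have "norm (gforce g t q - gforce g s q) \<le> 4 * C * Tail N + (L + \<epsilon> * C) * (V * \<bar>t - s\<bar>)"
      by (rule gforce_diff[OF g g V(2)[OF g]])
    also have "(L + \<epsilon> * C) * (V * \<bar>t - s\<bar>) \<le> (A + 1) * \<bar>t - s\<bar>"
      by (simp add: A_def algebra_simps)
    also have "\<dots> \<le> (A + 1) * (e / (2 * (A + 1)))"
      using A st by (intro mult_left_mono) auto
    also have "\<dots> = e / 2" using A by (rule half_cancel)
    finally show "norm (gforce g t q - gforce g s q) < e" using N by simp
  qed
qed

lemma gforce_jointly_equicontinuous:
  assumes e: "0 < e"
  obtains d where "0 < d" "\<And>g z w. force g \<Longrightarrow> norm (z - w) < d \<Longrightarrow>
    norm (gforce g (fst z) (snd z) - gforce g (fst w) (snd w)) < e"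
proof -
  obtain d where d: "0 < d" "\<And>g s t q. force g \<Longrightarrow> \<bar>t - s\<bar> < d \<Longrightarrow>
      norm (gforce g t q - gforce g s q) < e / 2"
    by (rule gforce_equicontinuous[of "e / 2"]) (use e in auto)
  show thesis
  proof (rule that[of "min d (e / (2 * (L + 1)))"])
    show "0 < min d (e / (2 * (L + 1)))" using d e L_nonneg by simp
    fix g and z w :: "real \<times> 'q"
    assume g: "force g" and zw: "norm (z - w) < min d (e / (2 * (L + 1)))"
    have t: "\<bar>fst z - fst w\<bar> < d" and q: "norm (snd z - snd w) < e / (2 * (L + 1))"
      using zw norm_fst_le_norm[of "z - w"] norm_snd_le_norm[of "z - w"] by auto
    have "norm (gforce g (fst w) (snd z) - gforce g (fst w) (snd w)) \<le> L * norm (snd z - snd w)"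
      by (rule gforce_lip[OF g])
    also have "\<dots> \<le> (L + 1) * (e / (2 * (L + 1)))"
      using L_nonneg q by (intro mult_mono) auto
    also have "\<dots> = e / 2" using L_nonneg by (rule half_cancel)
    finally show "norm (gforce g (fst z) (snd z) - gforce g (fst w) (snd w)) < e"
      using d(2)[OF g t, of "snd z"]
        norm_triangle_ineq[of "gforce g (fst z) (snd z) - gforce g (fst w) (snd z)"
          "gforce g (fst w) (snd z) - gforce g (fst w) (snd w)"] by simp
  qed
qed

lemma force_delay:
  assumes g: "force g"
  shows "force (\<lambda>t. gforce g (t - h))"
  unfolding force_def
proof (intro conjI allI norm_gforce_le gforce_lip g)
  have "continuous_on UNIV (\<lambda>z. gforce g (fst z) (snd z))"
    unfolding continuous_on_iff dist_norm
  proof (intro ballI allI impI)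
    fix w :: "real \<times> 'q" and e :: real assume "0 < e"
    then show "\<exists>d>0. \<forall>z\<in>UNIV. norm (z - w) < d \<longrightarrow>
        norm (gforce g (fst z) (snd z) - gforce g (fst w) (snd w)) < e"
      by (rule gforce_jointly_equicontinuous) (use g in blast)
  qed
  then show "continuous_on UNIV (\<lambda>(t, q). gforce g (t - h) q)"
    unfolding split_def
    by (rule continuous_on_compose2[of UNIV "\<lambda>z. gforce g (fst z) (snd z)" UNIV "\<lambda>z. (fst z - h, snd z)", simplified])
       (intro continuous_intros)
qed

text \<open>Trajectories up to time \<open>t\<close> read the force only before \<open>t\<close>.
  Stability with zero perturbation makes them equal at every truncation level, hence also in the
  limit.\<close>

lemma gforce_causal:
  assumes g: "force g" and h: "force h" and eq: "\<And>s. 0 \<le> s \<Longrightarrow> s < t \<Longrightarrow> g s = h s"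
  shows "gforce g t = gforce h t"
proof -
  have "Z g N x (max 0 t) = Z h N x (max 0 t)" for N x
  proof -
    obtain c where "\<And>g h \<delta> x. force g \<Longrightarrow> force h \<Longrightarrow> 0 \<le> \<delta> \<Longrightarrow>
      (\<And>s q. 0 < s \<Longrightarrow> s < max 0 t \<Longrightarrow> norm q \<le> N \<Longrightarrow> norm (g s q - h s q) \<le> \<delta>) \<Longrightarrow>
      norm (Z g N x (max 0 t) - Z h N x (max 0 t)) \<le> c * \<delta>"
      by (rule Z_stable_force[of "max 0 t" N]) auto
    from this[OF g h order_refl, of x] show ?thesis
      using eq by auto
  qed
  then show ?thesis
    by (simp add: fun_eq_iff gforce_def mass_def flow_def pos_def len_def wt_def)
qed

text \<open>Convergence on bounded times and balls is enough: up to the tail error only the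
  \<open>N\<close>-th truncation counts, and it reads the forces only in the ball of radius
  \<open>N\<close> up to time \<open>t\<close>.\<close>

lemma gforce_tendsto:
  assumes h: "\<And>n. force (h n)" and g: "force g"
    and conv: "\<And>e R. 0 < e \<Longrightarrow> \<exists>n0. \<forall>n\<ge>n0. \<forall>t q. 0 \<le> t \<longrightarrow> t \<le> R \<longrightarrow> norm q \<le> R \<longrightarrow> norm (h n t q - g t q) \<le> e"
  shows "(\<lambda>n. gforce (h n) t q) \<longlonglongrightarrow> gforce g t q"
proof (rule LIMSEQ_I)
  fix e :: real assume e: "0 < e"
  obtain N where N: "4 * C * Tail N < e / 2" using Tail_small[of "e / 2"] e by auto
  obtain c where c: "0 \<le> c" "\<And>g h \<delta> x. force g \<Longrightarrow> force h \<Longrightarrow> 0 \<le> \<delta> \<Longrightarrow>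
      (\<And>s q. 0 < s \<Longrightarrow> s < max 0 t \<Longrightarrow> norm q \<le> N \<Longrightarrow> norm (g s q - h s q) \<le> \<delta>) \<Longrightarrow>
      norm (Z g N x (max 0 t) - Z h N x (max 0 t)) \<le> c * \<delta>"
    by (rule Z_stable_force[of "max 0 t" N]) auto
  define A where "A = (L + \<epsilon> * C) * c"
  have A: "0 \<le> A" using L_nonneg C_nonneg c eps by (simp add: A_def)
  define \<delta> where "\<delta> = e / (2 * (A + 1))"
  have \<delta>: "0 < \<delta>" using e A by (simp add: \<delta>_def)
  \<comment> \<open>The assumption \<open>conv\<close> uses one radius for both times and positions,
    hence the maximum.\<close>
  obtain n0 where n0: "\<And>n s q. n \<ge> n0 \<Longrightarrow> 0 \<le> s \<Longrightarrow> s \<le> max (max 0 t) N \<Longrightarrow>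
      norm q \<le> max (max 0 t) N \<Longrightarrow> norm (h n s q - g s q) \<le> \<delta>"
    using conv[OF \<delta>, of "max (max 0 t) (real N)"] by blast
  have "norm (gforce (h n) t q - gforce g t q) < e" if n: "n \<ge> n0" for n
  proof -
    have "norm (gforce (h n) t q - gforce g t q) \<le> 4 * C * Tail N + (L + \<epsilon> * C) * (c * \<delta>)"
    proof (intro gforce_diff c h g)
      show "norm (h n s q - g s q) \<le> \<delta>" if "0 < s" "s < max 0 t" "norm q \<le> N" for s q
        by (rule n0) (use that n in auto)
    qed (use \<delta> in simp)
    also have "(L + \<epsilon> * C) * (c * \<delta>) \<le> (A + 1) * \<delta>"
      using \<delta> by (simp add: A_def algebra_simps)
    also have "\<dots> = e / 2" unfolding \<delta>_def using A by (rule half_cancel)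
    finally show ?thesis using N by simp
  qed
  then show "\<exists>n0. \<forall>n\<ge>n0. norm (gforce (h n) t q - gforce g t q) < e" by blast
qed

end

section \<open>Self-consistent forces\<close>

text \<open>Arzela-Ascoli on the balls of integer radius, followed by a diagonal choice. The limits
  found on different balls fit together because each of them is the pointwise limit.\<close>

lemma locally_uniform_subsequence:
  fixes F :: "nat \<Rightarrow> 'a::euclidean_space \<Rightarrow> 'b::euclidean_space"
  assumes M: "\<And>n x. norm (F n x) \<le> M"
    and equi: "\<And>e. 0 < e \<Longrightarrow> \<exists>d>0. \<forall>n x y. norm (x - y) < d \<longrightarrow> norm (F n x - F n y) < e"
  obtains f k where "strict_mono (k :: nat \<Rightarrow> nat)"
    "\<And>R e. 0 < e \<Longrightarrow> \<exists>N. \<forall>n\<ge>N. \<forall>x. norm x \<le> R \<longrightarrow> norm (F (k n) x - f x) < e"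
proof -
  define P where "P = (\<lambda>(i::nat) (r::nat \<Rightarrow> nat). \<exists>g. \<forall>e>0. \<exists>N. \<forall>n\<ge>N. \<forall>x\<in>cball 0 i. norm (F (r n) x - g x) < e)"
  obtain k where k: "strict_mono (k :: nat \<Rightarrow> nat)" "\<And>i. P i (id \<circ> k)"
  proof (rule subsequence_diagonalization_lemma[of P id])
    fix i and r :: "nat \<Rightarrow> nat"
    obtain g k where "strict_mono (k :: nat \<Rightarrow> nat)"
      "\<And>e. 0 < e \<Longrightarrow> \<exists>N. \<forall>n x. n \<ge> N \<and> x \<in> cball 0 (real i) \<longrightarrow> norm ((F \<circ> r) (k n) x - g x) < e"
    proof (rule Arzela_Ascoli[of "cball 0 (real i)" "F \<circ> r" M])
      fix x :: 'a and e :: real assume "0 < e"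
      from equi[OF this] show "\<exists>d>0. \<forall>n y. y \<in> cball 0 (real i) \<and> norm (x - y) < d \<longrightarrow>
          norm ((F \<circ> r) n x - (F \<circ> r) n y) < e" by fastforce
    qed (auto simp: M)
    then show "\<exists>k. strict_mono (k :: nat \<Rightarrow> nat) \<and> P i (r \<circ> k)"
      unfolding P_def o_def by blast
  next
    \<comment> \<open>The diagonal sequence is only eventually a subsequence of \<open>k1\<close>.
      As \<open>j \<le> j'\<close>, estimates valid from some index on carry over.\<close>
    fix i and r k1 k2 :: "nat \<Rightarrow> nat" and N
    assume "P i (r \<circ> k1)" and sub: "\<And>j. N \<le> j \<Longrightarrow> \<exists>j'. j \<le> j' \<and> k2 j = k1 j'"
    then obtain g where g: "\<And>e. e > 0 \<Longrightarrow> \<exists>N. \<forall>n\<ge>N. \<forall>x\<in>cball 0 i. norm (F ((r \<circ> k1) n) x - g x) < e"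
      unfolding P_def by blast
    show "P i (r \<circ> k2)"
      unfolding P_def
    proof (intro exI[of _ g] allI impI)
      fix e :: real assume "0 < e"
      then obtain N' where N': "\<forall>n\<ge>N'. \<forall>x\<in>cball 0 i. norm (F ((r \<circ> k1) n) x - g x) < e"
        using g by blast
      have "norm (F ((r \<circ> k2) n) x - g x) < e" if n: "n \<ge> max N N'" and "x \<in> cball 0 i" for n x
      proof -
        obtain j where "n \<le> j" "k2 n = k1 j" using sub n by (metis max.boundedE)
        then show ?thesis using N' that by auto
      qed
      then show "\<exists>N. \<forall>n\<ge>N. \<forall>x\<in>cball 0 i. norm (F ((r \<circ> k2) n) x - g x) < e" by blast
    qed
  qed blast
  have "\<forall>i. \<exists>g. \<forall>e>0. \<exists>N. \<forall>n\<ge>N. \<forall>x\<in>cball 0 (real i). norm (F (k n) x - g x) < e"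
    using k(2) by (simp add: P_def)
  then obtain g where g: "\<And>i e. 0 < e \<Longrightarrow> \<exists>N. \<forall>n\<ge>N. \<forall>x\<in>cball 0 (real i). norm (F (k n) x - g i x) < e"
    by metis
  define f where "f x = lim (\<lambda>n. F (k n) x)" for x
  have f: "g i x = f x" if "norm x \<le> real i" for i x
  proof -
    have "(\<lambda>n. F (k n) x) \<longlonglongrightarrow> g i x"
    proof (rule LIMSEQ_I)
      fix e :: real assume "0 < e"
      from g[OF this, of i] that show "\<exists>N. \<forall>n\<ge>N. norm (F (k n) x - g i x) < e"
        unfolding mem_cball_0[symmetric] by blast
    qed
    then show ?thesis by (simp add: f_def limI)
  qed
  show thesis
  proof (rule that[OF k(1)])
    fix R e :: real assume e: "0 < e"
    obtain i :: nat where i: "R \<le> i" using real_arch_simple by blast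
    obtain N where N: "\<And>n x. n \<ge> N \<Longrightarrow> x \<in> cball 0 (real i) \<Longrightarrow> norm (F (k n) x - g i x) < e"
      using g[OF e, of i] by blast
    have "norm (F (k n) x - f x) < e" if "n \<ge> N" "norm x \<le> R" for n x
      using N[OF that(1), of x] f[of x i] that(2) i by simp
    then show "\<exists>N. \<forall>n\<ge>N. \<forall>x. norm x \<le> R \<longrightarrow> norm (F (k n) x - f x) < e" by blast
  qed
qed

context damped_flow
begin

primrec delayed :: "real \<Rightarrow> nat \<Rightarrow> real \<Rightarrow> 'q \<Rightarrow> 'q" where
  "delayed h 0 = (\<lambda>t q. 0)"
| "delayed h (Suc k) = (\<lambda>t. gforce (delayed h k) (t - h))"

lemma force_delayed: "force (delayed h k)"
proof (induction k)
  case 0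
  show ?case using C_nonneg L_nonneg by (simp add: force_def split_def)
next
  case (Suc k)
  then show ?case by (simp add: force_delay)
qed

text \<open>Since \<open>gforce\<close> is causal, each iteration settles one more time interval of length \<open>h\<close>.\<close>

lemma delayed_fixed: "0 \<le> t \<Longrightarrow> t < k * h \<Longrightarrow> delayed h (Suc k) t = delayed h k t"
proof (induction k arbitrary: t)
  case (Suc k)
  \<comment> \<open>By causality only times s with 0 \<le> s < t - h matter. They satisfy s < k h,
    so the induction hypothesis covers them; for t \<le> h there are none.\<close>
  have "gforce (delayed h (Suc k)) (t - h) = gforce (delayed h k) (t - h)"
    by (rule gforce_causal[OF force_delayed force_delayed], rule Suc.IH)
       (use Suc.prems in \<open>auto simp: algebra_simps\<close>)
  then show ?case by simp
qed simp

text \<open>Tonelli's method: letting the delay tend to \<open>0\<close> yields a self-consistent force.\<close>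

lemma self_consistent_force:
  obtains g where "force g" "\<And>t. 0 \<le> t \<Longrightarrow> gforce g t = g t"
proof -
  define h :: "nat \<Rightarrow> real" where "h n = 1 / (real n + 1)" for n
  \<comment> \<open>With delay 1 / (n + 1), it takes (n + 1)^2 iterations to settle [0, n + 1), and
    these intervals exhaust the half-line.\<close>
  define G where "G n = delayed (h n) (Suc n * Suc n)" for n
  have h: "0 < h n" for n by (simp add: h_def)
  have h0: "h \<longlonglongrightarrow> 0"
    using LIMSEQ_inverse_real_of_nat by (simp add: h_def[abs_def] inverse_eq_divide add.commute)
  have G: "force (G n)" for n
    by (simp only: G_def force_delayed)
  \<comment> \<open>Exhibits \<open>G n\<close> as a generated force shifted in time. Thus it
    inherits the joint equicontinuity of \<open>gforce\<close>, with a modulus that does not depend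
    on \<open>n\<close>.\<close>
  have G_step: "G n = (\<lambda>t. gforce (delayed (h n) (n * Suc n + n)) (t - h n))" for n
    by (simp add: G_def add_ac)
  have G_fix: "gforce (G n) (t - h n) = G n t" if "0 \<le> t" "t < n + 1" for n t
  proof -
    have "delayed (h n) (Suc (Suc n * Suc n)) t = delayed (h n) (Suc n * Suc n) t"
    proof (rule delayed_fixed[OF that(1)])
      have "real (Suc n * Suc n) * h n = n + 1" by (simp add: h_def field_simps)
      then show "t < real (Suc n * Suc n) * h n" using that by simp
    qed
    then show ?thesis by (simp add: G_def del: mult_Suc mult_Suc_right)
  qed
  obtain f k where k: "strict_mono (k :: nat \<Rightarrow> nat)"
    and f: "\<And>R e. 0 < e \<Longrightarrow> \<exists>N. \<forall>n\<ge>N. \<forall>z. norm z \<le> R \<longrightarrow> norm (G (k n) (fst z) (snd z) - f z) < e"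
  proof (rule locally_uniform_subsequence[of "\<lambda>n z. G n (fst z) (snd z)" C])
    show "norm (G n (fst z) (snd z)) \<le> C" for n z using G[of n] by (simp add: force_def)
    fix e :: real assume "0 < e"
    then obtain d where d: "0 < d" "\<And>g z w. force g \<Longrightarrow> norm (z - w) < d \<Longrightarrow>
      norm (gforce g (fst z) (snd z) - gforce g (fst w) (snd w)) < e"
      by (rule gforce_jointly_equicontinuous) blast
    show "\<exists>d>0. \<forall>n z w. norm (z - w) < d \<longrightarrow> norm (G n (fst z) (snd z) - G n (fst w) (snd w)) < e"
    proof (intro exI[of _ d] conjI d allI impI)
      fix n and z w :: "real \<times> 'q" assume "norm (z - w) < d"
      then show "norm (G n (fst z) (snd z) - G n (fst w) (snd w)) < e"
        using d(2)[OF force_delayed, of "(fst z - h n, snd z)" "(fst w - h n, snd w)"]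
        by (simp add: G_step norm_prod_def)
    qed
  qed blast
  define g where "g t q = f (t, q)" for t q
  have conv: "\<exists>n0. \<forall>n\<ge>n0. \<forall>t q. 0 \<le> t \<longrightarrow> t \<le> R \<longrightarrow> norm q \<le> R \<longrightarrow> norm (G (k n) t q - g t q) \<le> e"
    if "0 < e" for e R
  proof -
    obtain N where N: "\<And>n z. n \<ge> N \<Longrightarrow> norm z \<le> R + R \<Longrightarrow> norm (G (k n) (fst z) (snd z) - f z) < e"
      using f[OF \<open>0 < e\<close>, of "R + R"] by blast
    have "norm (G (k n) t q - g t q) \<le> e" if "n \<ge> N" "0 \<le> t" "t \<le> R" "norm q \<le> R" for n t q
      using N[of n "(t, q)"] norm_Pair_le[of t q] that by (simp add: g_def)
    then show ?thesis by blast
  qed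
  have pointwise: "(\<lambda>n. G (k n) t q) \<longlonglongrightarrow> g t q" for t q
  proof (rule LIMSEQ_I)
    fix e :: real assume "0 < e"
    from f[OF this, of "norm (t, q)"] show "\<exists>N. \<forall>n\<ge>N. norm (G (k n) t q - g t q) < e"
      unfolding g_def by fastforce
  qed
  have g: "force g"
    unfolding force_def
  proof (intro conjI allI)
    show "norm (g t q) \<le> C" for t q
      by (rule LIMSEQ_le_const2[OF tendsto_norm[OF pointwise]]) (use G in \<open>auto simp: force_def\<close>)
    show "norm (g t q - g t r) \<le> L * norm (q - r)" for t q r
      by (rule LIMSEQ_le_const2[OF tendsto_norm[OF tendsto_diff[OF pointwise pointwise]]])
         (use G in \<open>auto simp: force_def\<close>)
    have "continuous_on (ball 0 R) f" for R
    proof (rule uniform_limit_theorem[where F = sequentially and f = "\<lambda>n z. G (k n) (fst z) (snd z)"])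
      show "\<forall>\<^sub>F n in sequentially. continuous_on (ball 0 R) (\<lambda>z. G (k n) (fst z) (snd z))"
      proof (intro always_eventually allI)
        fix n
        have "continuous_on UNIV (\<lambda>z. G (k n) (fst z) (snd z))"
          using G[of "k n"] by (simp add: force_def split_def)
        then show "continuous_on (ball 0 R) (\<lambda>z. G (k n) (fst z) (snd z))"
          by (rule continuous_on_subset) simp
      qed
      show "uniform_limit (ball 0 R) (\<lambda>n z. G (k n) (fst z) (snd z)) f sequentially"
        unfolding uniform_limit_sequentially_iff
      proof (intro allI impI)
        fix e :: real assume "0 < e"
        from f[OF this, of R] show "\<exists>N. \<forall>n\<ge>N. \<forall>z\<in>ball 0 R. dist (G (k n) (fst z) (snd z)) (f z) < e"
          unfolding dist_norm by (metis less_imp_le mem_ball_0)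
      qed
    qed simp
    then have "isCont f z" for z
      using continuous_on_eq_continuous_at[OF open_ball, of 0 "norm z + 1" f] by simp
    then show "continuous_on UNIV (\<lambda>(t, q). g t q)"
      by (simp add: g_def continuous_on_eq_continuous_at split_def)
  qed
  have "gforce g t q = g t q" if t: "0 \<le> t" for t q
  proof -
    \<comment> \<open>Equicontinuity in time, uniform over the forces \<open>G (k n)\<close>, lets
      the delay disappear in the limit. As soon as \<open>k n + 1\<close> exceeds \<open>t\<close>,
      \<open>G_fix\<close> turns the delayed term into \<open>G (k n)\<close> itself.\<close>
    have "(\<lambda>n. gforce (G (k n)) t q - gforce (G (k n)) (t - h (k n)) q) \<longlonglongrightarrow> 0"
    proof (rule LIMSEQ_I)
      fix e :: real assume "0 < e"
      then obtain d where d: "0 < d" "\<And>g s t q. force g \<Longrightarrow> \<bar>t - s\<bar> < d \<Longrightarrow> norm (gforce g t q - gforce g s q) < e"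
        by (rule gforce_equicontinuous) blast
      have "eventually (\<lambda>n. h (k n) < d) sequentially"
        using order_tendstoD(2)[OF LIMSEQ_subseq_LIMSEQ[OF h0 k] d(1)] by (simp add: o_def)
      then obtain N where "\<And>n. n \<ge> N \<Longrightarrow> h (k n) < d" by (auto simp: eventually_sequentially)
      then show "\<exists>N. \<forall>n\<ge>N. norm (gforce (G (k n)) t q - gforce (G (k n)) (t - h (k n)) q - 0) < e"
        using h by (intro exI[of _ N]) (auto intro!: d(2) G simp: abs_of_pos)
    qed
    moreover have "eventually (\<lambda>n. gforce (G (k n)) t q - gforce (G (k n)) (t - h (k n)) q
        = gforce (G (k n)) t q - G (k n) t q) sequentially"
    proof (rule eventually_sequentiallyI)
      fix n assume "nat \<lceil>t\<rceil> \<le> n"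
      then have "t < k n + 1" using seq_suble[OF k, of n] by linarith
      then show "gforce (G (k n)) t q - gforce (G (k n)) (t - h (k n)) q = gforce (G (k n)) t q - G (k n) t q"
        using t by (simp add: G_fix)
    qed
    ultimately have "(\<lambda>n. gforce (G (k n)) t q - G (k n) t q) \<longlonglongrightarrow> 0"
      by (rule Lim_transform_eventually)
    moreover have "(\<lambda>n. gforce (G (k n)) t q - G (k n) t q) \<longlonglongrightarrow> gforce g t q - g t q"
      by (intro tendsto_diff pointwise gforce_tendsto G g conv)
    ultimately have "gforce g t q - g t q = 0" by (rule LIMSEQ_unique[symmetric])
    then show ?thesis by simp
  qed
  then show thesis using g by (intro that[of g]) auto
qed

section \<open>The transported measures\<close>

lemma mass_pos_alive:
  assumes g: "force g" and "0 < mass g t x"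
  obtains N :: nat where "norm x + len g N t x \<le> N"
proof -
  have "\<exists>N::nat. norm x + len g N t x \<le> N"
  proof (rule ccontr)
    assume "\<not> ?thesis"
    then have "mass g t x \<le> tail N x" for N by (intro flow_dead g) (auto simp: not_le)
    then have "mass g t x \<le> 0" by (intro LIMSEQ_le_const[OF tail_tendsto[of x]]) auto
    then show False using assms by simp
  qed
  then show thesis using that by blast
qed

lemma moment_decreasing:
  assumes g: "force g" and \<alpha>: "0 \<le> \<alpha>" "\<alpha> \<le> \<epsilon>" and st: "0 \<le> s" "s \<le> t"
  shows "mass g t x * exp (\<alpha> * norm (flow g t x)) \<le> mass g s x * exp (\<alpha> * norm (flow g s x))"
proof (cases "0 < mass g t x")
  case True
  then obtain N :: nat where t: "norm x + len g N t x \<le> N" by (rule mass_pos_alive[OF g])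
  \<comment> \<open>Length is monotone in time, so a single truncated trajectory describes the flow
    at both times.\<close>
  have s: "norm x + len g N s x \<le> N" using t len_mono[OF g st, of N x] by linarith
  let ?l = "len g N t x - len g N s x"
  have "norm (pos g N t x) - norm (pos g N s x) \<le> ?l"
    using pos_dist_le_len[OF g st, of N x] norm_triangle_ineq2[of "pos g N t x" "pos g N s x"] by linarith
  then have "\<alpha> * (norm (pos g N t x) - norm (pos g N s x)) \<le> \<alpha> * ?l"
    using \<alpha> by (intro mult_left_mono)
  also have "\<dots> \<le> \<epsilon> * ?l" using \<alpha> len_mono[OF g st, of N x] by (intro mult_right_mono) auto
  finally show ?thesis
    by (simp add: flow_alive[OF g t] flow_alive[OF g s] wt_def algebra_simps flip: exp_add)
next
  case False
  then have "mass g t x = 0" using mass_bounds(1)[OF g, of t x] by simp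
  then show ?thesis using mass_bounds[OF g, of s x] by simp
qed

lemma flow_0:
  assumes g: "force g"
  shows "flow g 0 x = x" "mass g 0 x = 1"
proof -
  obtain N :: nat where "norm x \<le> N" using real_arch_simple by blast
  then have "norm x + len g N 0 x \<le> N" using g by simp
  then show "flow g 0 x = x" "mass g 0 x = 1"
    using g by (simp_all add: flow_alive[OF g] wt_def)
qed

text \<open>The weight is applied before the push-forward, so the arbitrary values of
  \<open>flow\<close> at escaped initial points carry no mass.\<close>

definition evolution :: "(real \<Rightarrow> 'q \<Rightarrow> 'q) \<Rightarrow> real \<Rightarrow> ('q \<times> 'q) measure" where
  "evolution g t = distr (density \<mu>\<^sub>0 (mass g t)) borel (flow g t)"

lemma sets_evolution [simp]: "sets (evolution g t) = sets borel"
  by (simp add: evolution_def)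

lemma evolution_integral:
  fixes f :: "'q \<times> 'q \<Rightarrow> 'b::{banach, second_countable_topology}"
  assumes g: "force g" and f [measurable]: "f \<in> borel_measurable borel"
  shows "(\<integral>x. f x \<partial>evolution g t) = (\<integral>x. mass g t x *\<^sub>R f (flow g t x) \<partial>\<mu>\<^sub>0)"
    "integrable (evolution g t) f \<longleftrightarrow> integrable \<mu>\<^sub>0 (\<lambda>x. mass g t x *\<^sub>R f (flow g t x))"
proof -
  note [measurable] = flow_measurable'[OF g]
  have [measurable]: "flow g t \<in> density \<mu>\<^sub>0 (mass g t) \<rightarrow>\<^sub>M borel" by simp
  show "(\<integral>x. f x \<partial>evolution g t) = (\<integral>x. mass g t x *\<^sub>R f (flow g t x) \<partial>\<mu>\<^sub>0)"
    unfolding evolution_def by (simp add: integral_distr integral_density mass_bounds[OF g])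
  show "integrable (evolution g t) f \<longleftrightarrow> integrable \<mu>\<^sub>0 (\<lambda>x. mass g t x *\<^sub>R f (flow g t x))"
    unfolding evolution_def by (simp add: integrable_distr_eq integrable_density mass_bounds[OF g])
qed

lemma evolution_exp_moment:
  assumes g: "force g"
  shows "exp_moment \<alpha> (evolution g t) = (\<integral>\<^sup>+x. ennreal (mass g t x * exp (\<alpha> * norm (flow g t x))) \<partial>\<mu>\<^sub>0)"
proof -
  note [measurable] = flow_measurable'[OF g]
  have [measurable]: "flow g t \<in> density \<mu>\<^sub>0 (mass g t) \<rightarrow>\<^sub>M borel" by simp
  show ?thesis
    unfolding evolution_def exp_moment_def
    by (simp add: nn_integral_distr nn_integral_density ennreal_mult mass_bounds[OF g])
qed

lemma evolution_0: "force g \<Longrightarrow> evolution g 0 = \<mu>\<^sub>0"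
proof -
  assume g: "force g"
  have "evolution g 0 = distr (density \<mu>\<^sub>0 (\<lambda>_. 1)) borel (\<lambda>x. x)"
    unfolding evolution_def by (simp add: flow_0[OF g, abs_def])
  also have "\<dots> = \<mu>\<^sub>0"
    unfolding density_1 by (rule distr_id2[OF sets_mu0[symmetric]])
  finally show ?thesis .
qed

lemma evolution_exp_moment_antimono:
  assumes g: "force g" and \<alpha>: "0 \<le> \<alpha>" "\<alpha> \<le> \<epsilon>" and st: "0 \<le> s" "s \<le> t"
  shows "exp_moment \<alpha> (evolution g t) \<le> exp_moment \<alpha> (evolution g s)"
  unfolding evolution_exp_moment[OF g]
  by (intro nn_integral_mono ennreal_leI moment_decreasing assms)

text \<open>The truncation error \<open>2 * B * tail N x\<close> is independent of time, so this is
  a uniform limit of continuous functions. In particular there is no jump at the time of escape,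
  although \<open>flow\<close> itself may be discontinuous there.\<close>

lemma flow_time_continuous:
  fixes f :: "'q \<times> 'q \<Rightarrow> 'b::real_normed_vector"
  assumes g: "force g" and cont: "continuous_on UNIV f" and f: "\<And>x. norm (f x) \<le> B"
  shows "continuous_on UNIV (\<lambda>t. mass g t x *\<^sub>R f (flow g t x))"
proof (rule uniform_limit_theorem)
  show "\<forall>\<^sub>F N in sequentially. continuous_on UNIV (\<lambda>t. wt g N t x *\<^sub>R f (pos g N t x))"
    unfolding wt_def
    by (intro always_eventually allI continuous_intros pos_len_continuous_time[OF g]
        continuous_on_compose2[OF cont pos_len_continuous_time(1)[OF g]]) auto
  show "uniform_limit UNIV (\<lambda>N t. wt g N t x *\<^sub>R f (pos g N t x)) (\<lambda>t. mass g t x *\<^sub>R f (flow g t x)) sequentially"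
  proof (rule uniform_limitI)
    fix e :: real assume e: "0 < e"
    have "(\<lambda>N. 2 * B * tail N x) \<longlonglongrightarrow> 2 * B * 0" by (intro tendsto_intros tail_tendsto)
    then have "\<forall>\<^sub>F N in sequentially. 2 * B * tail N x < e" using e by (intro order_tendstoD) auto
    then show "\<forall>\<^sub>F N in sequentially. \<forall>t\<in>UNIV. dist (wt g N t x *\<^sub>R f (pos g N t x)) (mass g t x *\<^sub>R f (flow g t x)) < e"
      by eventually_elim (auto simp: dist_norm norm_minus_commute intro: order_le_less_trans[OF flow_approx[OF g f]])
  qed
qed simp

lemma evolution_narrowly_continuous:
  assumes g: "force g"
  shows "narrowly_continuous_on S (evolution g)"
  unfolding narrowly_continuous_on_def
proof (intro allI impI)
  fix \<phi> :: "'q \<times> 'q \<Rightarrow> real"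
  assume cont: "continuous_on UNIV \<phi>" and "bounded (range \<phi>)"
  then obtain B where B: "\<And>x. norm (\<phi> x) \<le> B" by (auto simp: bounded_iff)
  have [measurable]: "\<phi> \<in> borel_measurable borel" using cont by (rule borel_measurable_continuous_onI)
  note [measurable] = flow_measurable'[OF g]
  show "continuous_on S (\<lambda>t. \<integral>x. \<phi> x \<partial>evolution g t)"
    unfolding continuous_on_sequentially o_def
  proof (intro allI ballI impI, elim conjE)
    fix u :: "nat \<Rightarrow> real" and a assume u: "u \<longlonglongrightarrow> a"
    show "(\<lambda>n. \<integral>x. \<phi> x \<partial>evolution g (u n)) \<longlonglongrightarrow> (\<integral>x. \<phi> x \<partial>evolution g a)"
      unfolding evolution_integral(1)[OF g \<open>\<phi> \<in> _\<close>]
    proof (rule integral_dominated_convergence[where w = "\<lambda>_. B"])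
      show "AE x in \<mu>\<^sub>0. (\<lambda>n. mass g (u n) x *\<^sub>R \<phi> (flow g (u n) x)) \<longlonglongrightarrow> mass g a x *\<^sub>R \<phi> (flow g a x)"
        using flow_time_continuous[OF g cont B] u
        by (intro AE_I2 continuous_on_tendsto_compose[of UNIV "\<lambda>t. mass g t x *\<^sub>R \<phi> (flow g t x)" for x]) auto
      show "AE x in \<mu>\<^sub>0. norm (mass g (u n) x *\<^sub>R \<phi> (flow g (u n) x)) \<le> B" for n
        using mult_mono[OF mass_bounds(2)[OF g] B] mass_bounds(1)[OF g] by (intro AE_I2) (simp add: abs_mult)
    qed auto
  qed
qed

section \<open>The distributional equation, checked on each characteristic\<close>

lemma space_time_integral:
  assumes g: "force g" and [measurable]: "\<psi>' \<in> borel_measurable borel" and B: "\<And>z. norm (\<psi>' z :: real) \<le> B"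
  shows "set_integrable lborel {0<..<T} (\<lambda>t. \<integral>x. mass g t x * \<psi>' (t, flow g t x) \<partial>\<mu>\<^sub>0)"
    and "(LINT t:{0<..<T}|lborel. \<integral>x. mass g t x * \<psi>' (t, flow g t x) \<partial>\<mu>\<^sub>0) =
      (\<integral>x. (LINT t:{0<..<T}|lborel. mass g t x * \<psi>' (t, flow g t x)) \<partial>\<mu>\<^sub>0)"
proof -
  interpret P: pair_sigma_finite lborel \<mu>\<^sub>0 ..
  define F where "F t x = indicator {0<..<T} t * (mass g t x * \<psi>' (t, flow g t x))" for t x
  have sets_eq: "sets (lborel \<Otimes>\<^sub>M \<mu>\<^sub>0) = sets borel"
    using sets_pair_measure_cong[OF sets_lborel sets_mu0] by (simp only: borel_prod)
  note flow_meas = flow_measurable[OF g, unfolded split_def]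
  have fst_meas: "fst \<in> borel_measurable (borel :: (real \<times> 'q \<times> 'q) measure)"
    by (intro borel_measurable_continuous_onI continuous_intros)
  have "(\<lambda>z. \<psi>' (fst z, flow g (fst z) (snd z))) \<in> borel_measurable borel"
    by (rule measurable_compose[OF borel_measurable_Pair[OF fst_meas flow_meas(1)] assms(2)])
  then have "case_prod F \<in> borel_measurable borel"
    unfolding F_def split_def
    by (intro borel_measurable_times flow_meas(2) measurable_compose[OF fst_meas]) auto
  then have meas: "case_prod F \<in> borel_measurable (lborel \<Otimes>\<^sub>M \<mu>\<^sub>0)"
    by (simp add: measurable_cong_sets[OF sets_eq refl])
  have int: "integrable (lborel \<Otimes>\<^sub>M \<mu>\<^sub>0) (case_prod F)"
  proof (rule Bochner_Integration.integrable_bound[OF _ meas])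
    have "emeasure (lborel \<Otimes>\<^sub>M \<mu>\<^sub>0) ({0<..<T} \<times> UNIV) = emeasure lborel {0<..<T} * emeasure \<mu>\<^sub>0 UNIV"
      by (rule emeasure_pair_measure_Times) (auto simp: sets_mu0)
    then have "emeasure (lborel \<Otimes>\<^sub>M \<mu>\<^sub>0) ({0<..<T} \<times> UNIV) < \<infinity>"
      by (cases "0 \<le> T") (simp_all add: mass_mu0)
    then show "integrable (lborel \<Otimes>\<^sub>M \<mu>\<^sub>0) (\<lambda>z. B * indicator ({0<..<T} \<times> UNIV) z)"
      by (intro integrable_mult_right integrable_real_indicator pair_measureI) (auto simp: sets_mu0)
    have "norm (F t x) \<le> norm (B * indicator ({0<..<T} \<times> UNIV) (t, x))" for t x
    proof -
      have "mass g t x * norm (\<psi>' (t, flow g t x)) \<le> 1 * B"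
        by (intro mult_mono mass_bounds g B) auto
      then show ?thesis
        using mass_bounds(1)[OF g, of t x] by (auto simp: F_def indicator_def abs_mult)
    qed
    then show "AE z in lborel \<Otimes>\<^sub>M \<mu>\<^sub>0. norm (case_prod F z) \<le> norm (B * indicator ({0<..<T} \<times> UNIV) z)"
      by (intro AE_I2) auto
  qed
  show "set_integrable lborel {0<..<T} (\<lambda>t. \<integral>x. mass g t x * \<psi>' (t, flow g t x) \<partial>\<mu>\<^sub>0)"
    using P.integrable_fst'[OF int] by (simp add: set_integrable_def F_def)
  show "(LINT t:{0<..<T}|lborel. \<integral>x. mass g t x * \<psi>' (t, flow g t x) \<partial>\<mu>\<^sub>0) =
      (\<integral>x. (LINT t:{0<..<T}|lborel. mass g t x * \<psi>' (t, flow g t x)) \<partial>\<mu>\<^sub>0)"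
    using P.Fubini_integral[OF int] by (simp add: set_lebesgue_integral_def F_def)
qed

text \<open>The factor \<open>mass\<close> turns the equation along a single characteristic into an exact derivative.
  Characteristics that leave every ball in finite time cause no boundary term, because their
  mass has vanished by then.\<close>

lemma characteristic_identity:
  fixes \<phi> :: "real \<times> 'q \<times> 'q \<Rightarrow> real"
  assumes g: "force g" and T: "0 < T"
    and D: "\<And>z. (\<phi> has_derivative D z) (at z)"
    and supp_t: "\<And>t x. \<not> (0 < t \<and> t < T) \<Longrightarrow> \<phi> (t, x) = 0"
    and supp_x: "\<And>t x. R < norm x \<Longrightarrow> \<phi> (t, x) = 0 \<and> D (t, x) = (\<lambda>_. 0)"
    and \<psi>': "\<And>t x. \<psi>' (t, x) = D (t, x) (1, vel g t x) - \<epsilon> * norm (vel g t x) * \<phi> (t, x)"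
    and cont: "continuous_on UNIV \<psi>'" and B: "\<And>z. norm (\<psi>' z) \<le> B"
  shows "(LINT t:{0<..<T}|lborel. mass g t x * \<psi>' (t, flow g t x)) = 0"
proof -
  \<comment> \<open>For \<open>R \<le> N\<close> the truncation is invisible: inside the ball of
    radius \<open>R\<close> it is the identity, and outside it \<open>\<phi>\<close> and its
    derivative vanish. The boundary terms are 0 since \<open>\<phi>\<close> vanishes at the times 0
    and T.\<close>
  have trunc_eq: "(LINT t:{0<..<T}|lborel. wt g N t x * \<psi>' (t, pos g N t x)) = 0" if N: "R \<le> N" for N :: nat
  proof -
    let ?F = "\<lambda>t. wt g N t x * \<phi> (t, pos g N t x)"
    have cont_phi: "continuous_on UNIV \<phi>"
      using D by (intro has_derivative_continuous_on) (auto simp: has_derivative_at_withinI)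
    have pc: "continuous_on S (\<lambda>t. (t, pos g N t x))" for S
      by (intro continuous_intros continuous_on_subset[OF pos_len_continuous_time(1)[OF g]]) auto
    have wc: "continuous_on S (\<lambda>t. wt g N t x)" for S
      unfolding wt_def
      by (intro continuous_intros continuous_on_subset[OF pos_len_continuous_time(2)[OF g]]) auto
    have hc: "continuous_on S (\<lambda>t. wt g N t x * \<psi>' (t, pos g N t x))" for S
      by (intro continuous_intros wc continuous_on_compose2[OF cont pc]) auto
    have "((\<lambda>t. wt g N t x * \<psi>' (t, pos g N t x)) has_integral ?F T - ?F 0) {0..T}"
    proof (rule fundamental_theorem_of_calculus_interior)
      show "continuous_on {0..T} ?F"
        by (intro continuous_intros wc continuous_on_compose2[OF cont_phi pc]) auto
      fix t assume "t \<in> {0<..<T}"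
      then have t: "0 < t" by simp
      let ?x = "pos g N t x" and ?v = "vel g t (trunc N (pos g N t x))"
      have "((\<lambda>t. (t, pos g N t x)) has_vector_derivative (1, ?v)) (at t)"
        using pos_deriv(1)[OF g t, of N x]
        by (intro has_vector_derivative_Pair) (auto simp: has_vector_derivative_id)
      then have *: "((\<lambda>t. \<phi> (t, pos g N t x)) has_real_derivative D (t, ?x) (1, ?v)) (at t)"
        using vector_derivative_diff_chain_within[of "\<lambda>t. (t, pos g N t x)" "(1, ?v)" t UNIV \<phi> "D (t, ?x)"] D
        by (simp add: has_real_derivative_iff_has_vector_derivative o_def has_derivative_at_withinI)
      have "((\<lambda>t. wt g N t x) has_real_derivative wt g N t x * (- (\<epsilon> * norm ?v))) (at t)"
        unfolding wt_def using pos_deriv(2)[OF g t, of N x]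
        by (auto intro!: derivative_eq_intros simp: has_real_derivative_iff_has_vector_derivative[symmetric])
      from DERIV_mult[OF this *]
      have "(?F has_real_derivative wt g N t x * (D (t, ?x) (1, ?v) - \<epsilon> * norm ?v * \<phi> (t, ?x))) (at t)"
        by (rule DERIV_cong) (simp add: algebra_simps)
      moreover have "D (t, ?x) (1, ?v) - \<epsilon> * norm ?v * \<phi> (t, ?x) = \<psi>' (t, ?x)"
      proof (cases "R < norm ?x")
        case True
        then show ?thesis using supp_x by (simp add: \<psi>')
      next
        case False
        then show ?thesis using N by (simp add: trunc_id \<psi>')
      qed
      ultimately show "(?F has_vector_derivative wt g N t x * \<psi>' (t, ?x)) (at t)"
        by (simp add: has_real_derivative_iff_has_vector_derivative)
    qed (use T in simp)
    then have "((\<lambda>t. wt g N t x * \<psi>' (t, pos g N t x)) has_integral 0) {0<..<T}"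
      by (simp add: supp_t has_integral_Icc_iff_Ioo)
    moreover have "set_integrable lborel {0<..<T} (\<lambda>t. wt g N t x * \<psi>' (t, pos g N t x))"
      by (rule set_integrable_subset[OF borel_integrable_atLeastAtMost'[OF hc[of "{0..T}"]]]) auto
    ultimately show ?thesis
      by (simp add: set_borel_integral_eq_integral integral_unique)
  qed
  \<comment> \<open>The truncated integrals are all 0 from some level on. It remains to pass to the
    limit, with \<open>B\<close> on the bounded interval as dominating function.\<close>
  have "(\<lambda>N. LINT t:{0<..<T}|lborel. wt g N t x * \<psi>' (t, pos g N t x))
      \<longlonglongrightarrow> (LINT t:{0<..<T}|lborel. mass g t x * \<psi>' (t, flow g t x))"
    unfolding set_lebesgue_integral_def
  proof (rule integral_dominated_convergence[where w = "\<lambda>t. B * indicator {0<..<T} t"])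
    have psi_meas [measurable]: "\<psi>' \<in> borel_measurable borel"
      using cont by (rule borel_measurable_continuous_onI)
    have pair: "(\<lambda>t. (t, x)) \<in> borel_measurable (borel :: real measure)"
      by (intro borel_measurable_continuous_onI continuous_intros)
    have [measurable]: "(\<lambda>t. flow g t x) \<in> borel_measurable borel" "(\<lambda>t. mass g t x) \<in> borel_measurable borel"
        "(\<lambda>t. pos g N t x) \<in> borel_measurable borel" "(\<lambda>t. wt g N t x) \<in> borel_measurable borel" for N
      using measurable_compose[OF pair flow_measurable(1)[OF g]] measurable_compose[OF pair flow_measurable(2)[OF g]]
        measurable_compose[OF pair Z_measurable(1)[OF g]] measurable_compose[OF pair Z_measurable(3)[OF g]]
      by simp_all
    show "(\<lambda>t. indicat_real {0<..<T} t *\<^sub>R (mass g t x * \<psi>' (t, flow g t x))) \<in> borel_measurable lborel"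
      by measurable
    show "(\<lambda>t. indicat_real {0<..<T} t *\<^sub>R (wt g N t x * \<psi>' (t, pos g N t x))) \<in> borel_measurable lborel" for N
      by measurable
    show "integrable lborel (\<lambda>t. B * indicator {0<..<T} t)"
      using T by (intro integrable_mult_right integrable_real_indicator) auto
    show "AE t in lborel. (\<lambda>N. indicat_real {0<..<T} t *\<^sub>R (wt g N t x * \<psi>' (t, pos g N t x)))
        \<longlonglongrightarrow> indicat_real {0<..<T} t *\<^sub>R (mass g t x * \<psi>' (t, flow g t x))"
      using flow_tendsto[OF g, of "\<lambda>y. \<psi>' (t, y)" B t x for t] B
      by (intro AE_I2 tendsto_scaleR[OF tendsto_const]) simp
    show "AE t in lborel. norm (indicat_real {0<..<T} t *\<^sub>R (wt g N t x * \<psi>' (t, pos g N t x)))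
        \<le> B * indicator {0<..<T} t" for N
      using mult_mono[OF wt_bounds(2)[OF g, of N _ x] B] wt_bounds(1)[OF g, of N _ x, THEN less_imp_le]
      by (intro AE_I2) (auto simp: indicator_def abs_mult)
  qed
  moreover have "(\<lambda>N. LINT t:{0<..<T}|lborel. wt g N t x * \<psi>' (t, pos g N t x)) \<longlonglongrightarrow> 0"
  proof (rule tendsto_eventually, rule eventually_sequentiallyI)
    fix N assume "nat \<lceil>R\<rceil> \<le> N"
    then have "R \<le> N" by linarith
    then show "(LINT t:{0<..<T}|lborel. wt g N t x * \<psi>' (t, pos g N t x)) = 0" by (rule trunc_eq)
  qed
  ultimately show ?thesis by (rule LIMSEQ_unique)
qed

lemma finite_evolution: "force g \<Longrightarrow> 0 \<le> t \<Longrightarrow> finite_measure (evolution g t)"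
proof
  assume g: "force g" and t: "0 \<le> t"
  have "emeasure (evolution g t) (space (evolution g t)) = exp_moment 0 (evolution g t)"
    by (simp add: exp_moment_def)
  also have "\<dots> \<le> exp_moment 0 (evolution g 0)"
    using eps by (intro evolution_exp_moment_antimono g t) auto
  also have "\<dots> = 1" using mass_mu0 by (simp add: evolution_0[OF g] exp_moment_def)
  finally show "emeasure (evolution g t) (space (evolution g t)) \<noteq> \<infinity>" by (auto simp: top_unique)
qed

lemma evolution_gforce:
  assumes "force g"
  shows "(\<integral>x. K (q - snd x) \<partial>evolution g t) = gforce g t q"
  by (simp add: gforce_def evolution_integral[OF assms K_measurable])

text \<open>The velocity is kept as a separate \<open>v\<close>, to be matched with
  \<open>vel g\<close> at positive times only: the equation lives on (0, T), and self-consistency of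
  the force is only available from time 0 on.\<close>

lemma evolution_deficient_continuity_eq:
  assumes g: "force g" and T: "0 < T" and v: "\<And>t x. 0 < t \<Longrightarrow> v t x = vel g t x"
  shows "deficient_continuity_eq \<epsilon> T v (evolution g)"
  unfolding deficient_continuity_eq_def Let_def
proof
  fix \<phi> :: "real \<times> 'q \<times> 'q \<Rightarrow> real"
  assume "\<phi> \<in> test_functions ({0<..<T} \<times> UNIV)"
  then have Ck: "\<And>k. Ck k \<phi>" and supp: "compact (supp \<phi>)" "supp \<phi> \<subseteq> {0<..<T} \<times> UNIV"
    by (auto simp: test_functions_def)
  note diff = Ck_Suc_differentiable[OF Ck]
  \<comment> \<open>The two integrands as functions on space-time. Although the velocity may be
    unbounded, \<open>a\<close> and \<open>b\<close> are continuous with compact support, hence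
    bounded, which settles all integrability questions.\<close>
  define a where "a z = grad \<phi> z \<bullet> (1, vel g (fst z) (snd z))" for z
  define b where "b z = \<epsilon> * norm (vel g (fst z) (snd z)) * \<phi> z" for z
  have vel_cont: "continuous_on UNIV (\<lambda>z. vel g (fst z) (snd z))"
    using vel_continuous[OF g] by (simp add: split_def)
  have a_cont: "continuous_on UNIV a" and b_cont: "continuous_on UNIV b"
    unfolding a_def b_def
    by (intro continuous_intros vel_cont Ck_grad_continuous[OF Ck] Ck_continuous[OF Ck])+
  have zero: "a z = 0" "b z = 0" if "z \<notin> supp \<phi>" for z
    using that by (simp_all add: a_def b_def grad_0_outside_supp eq_0_outside_supp[of z \<phi>])
  obtain A where A: "\<And>z. norm (a z) \<le> A"
    using compactly_supported_bounded[OF a_cont supp(1) zero(1)] by blast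
  obtain B where B: "\<And>z. norm (b z) \<le> B"
    using compactly_supported_bounded[OF b_cont supp(1) zero(2)] by blast
  have AB: "norm (a z - b z) \<le> A + B" for z
    using norm_triangle_ineq4[of "a z" "b z"] A[of z] B[of z] by linarith
  have meas: "a \<in> borel_measurable borel" "b \<in> borel_measurable borel" "(\<lambda>z. a z - b z) \<in> borel_measurable borel"
    by (intro borel_measurable_continuous_onI continuous_intros a_cont b_cont)+
  have meas_slice: "(\<lambda>x. a (t, x)) \<in> borel_measurable borel" "(\<lambda>x. b (t, x)) \<in> borel_measurable borel" for t
    by (intro borel_measurable_continuous_onI continuous_on_compose2[OF a_cont]
        continuous_on_compose2[OF b_cont] continuous_intros; simp)+
  have transport: "deriv (\<lambda>s. \<phi> (s, x)) t + v t x \<bullet> grad (\<lambda>y. \<phi> (t, y)) x = a (t, x)"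
    and loss: "\<epsilon> * norm (v t x) * \<phi> (t, x) = b (t, x)" if "0 < t" for t x
    using that by (auto simp: partial_derivatives[OF diff] a_def b_def v inner_prod_def inner_commute)
  have int: "integrable \<mu>\<^sub>0 (\<lambda>x. mass g t x * a (t, flow g t x))" "integrable \<mu>\<^sub>0 (\<lambda>x. mass g t x * b (t, flow g t x))" for t
    using integrable_flow(1)[OF g meas_slice(1) A] integrable_flow(1)[OF g meas_slice(2) B] by auto
  have int_ev: "integrable (evolution g t) (\<lambda>x. a (t, x))" "integrable (evolution g t) (\<lambda>x. b (t, x))" for t
    using int by (simp_all add: evolution_integral(2)[OF g] meas_slice)
  let ?a = "\<lambda>t. \<integral>x. mass g t x * a (t, flow g t x) \<partial>\<mu>\<^sub>0" and ?b = "\<lambda>t. \<integral>x. mass g t x * b (t, flow g t x) \<partial>\<mu>\<^sub>0"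
  have a_eq: "(\<integral>x. deriv (\<lambda>s. \<phi> (s, x)) t + v t x \<bullet> grad (\<lambda>y. \<phi> (t, y)) x \<partial>evolution g t) = ?a t"
    and b_eq: "(\<integral>x. \<epsilon> * norm (v t x) * \<phi> (t, x) \<partial>evolution g t) = ?b t" if "t \<in> {0<..<T}" for t
    using that by (simp_all add: transport loss evolution_integral(1)[OF g] meas_slice)
  have a_int: "set_integrable lborel {0<..<T} ?a" and b_int: "set_integrable lborel {0<..<T} ?b"
    using space_time_integral(1)[OF g meas(1) A] space_time_integral(1)[OF g meas(2) B] by auto
  obtain R where R: "\<And>z. z \<in> supp \<phi> \<Longrightarrow> norm z \<le> R"
    using compact_imp_bounded[OF supp(1)] by (auto simp: bounded_iff)
  \<comment> \<open>Only after exchanging the integrals over time and initial points does the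
    difference become a quantity that vanishes for every single characteristic.\<close>
  have "(LINT t:{0<..<T}|lborel. ?a t) - (LINT t:{0<..<T}|lborel. ?b t) = (LINT t:{0<..<T}|lborel. ?a t - ?b t)"
    by (rule set_integral_diff(2)[OF a_int b_int, symmetric])
  also have "\<dots> = (LINT t:{0<..<T}|lborel. \<integral>x. mass g t x * (a (t, flow g t x) - b (t, flow g t x)) \<partial>\<mu>\<^sub>0)"
    by (simp add: right_diff_distrib int)
  also have "\<dots> = (\<integral>x. (LINT t:{0<..<T}|lborel. mass g t x * (a (t, flow g t x) - b (t, flow g t x))) \<partial>\<mu>\<^sub>0)"
    by (rule space_time_integral(2)[OF g meas(3) AB])
  also have "\<dots> = 0"
  proof -
    have "(LINT t:{0<..<T}|lborel. mass g t x * (a (t, flow g t x) - b (t, flow g t x))) = 0" for x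
    proof (rule characteristic_identity[OF g T has_derivative_grad[OF diff], where \<psi>' = "\<lambda>z. a z - b z" and B = "A + B"])
      fix t x
      show "\<not> (0 < t \<and> t < T) \<Longrightarrow> \<phi> (t, x) = 0"
        using supp(2) by (intro eq_0_outside_supp) auto
      assume "R < norm x"
      then have "(t, x) \<notin> supp \<phi>" using R[of "(t, x)"] norm_snd_le_norm[of "(t, x)"] by auto
      then show "\<phi> (t, x) = 0 \<and> (\<lambda>h. grad \<phi> (t, x) \<bullet> h) = (\<lambda>_. 0)"
        by (simp add: eq_0_outside_supp[of _ \<phi>] grad_0_outside_supp)
    next
      show "continuous_on UNIV (\<lambda>z. a z - b z)" by (intro continuous_on_diff a_cont b_cont)
    qed (use AB in \<open>simp_all add: a_def b_def\<close>)
    then show ?thesis by simp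
  qed
  finally have eq: "(LINT t:{0<..<T}|lborel. ?a t) = (LINT t:{0<..<T}|lborel. ?b t)" by simp
  show "(\<forall>t\<in>{0<..<T}. integrable (evolution g t) (\<lambda>x. deriv (\<lambda>s. \<phi> (s, x)) t + v t x \<bullet> grad (\<lambda>y. \<phi> (t, y)) x) \<and>
        integrable (evolution g t) (\<lambda>x. \<epsilon> * norm (v t x) * \<phi> (t, x))) \<and>
      set_integrable lborel {0<..<T} (\<lambda>t. \<integral>x. deriv (\<lambda>s. \<phi> (s, x)) t + v t x \<bullet> grad (\<lambda>y. \<phi> (t, y)) x \<partial>evolution g t) \<and>
      set_integrable lborel {0<..<T} (\<lambda>t. \<integral>x. \<epsilon> * norm (v t x) * \<phi> (t, x) \<partial>evolution g t) \<and>
      (LINT t:{0<..<T}|lborel. \<integral>x. deriv (\<lambda>s. \<phi> (s, x)) t + v t x \<bullet> grad (\<lambda>y. \<phi> (t, y)) x \<partial>evolution g t) =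
      (LINT t:{0<..<T}|lborel. \<integral>x. \<epsilon> * norm (v t x) * \<phi> (t, x) \<partial>evolution g t)"
  proof (intro conjI ballI)
    show "set_integrable lborel {0<..<T} (\<lambda>t. \<integral>x. deriv (\<lambda>s. \<phi> (s, x)) t + v t x \<bullet> grad (\<lambda>y. \<phi> (t, y)) x \<partial>evolution g t)"
      using a_int by (subst set_integrable_cong[OF refl refl a_eq])
    show "set_integrable lborel {0<..<T} (\<lambda>t. \<integral>x. \<epsilon> * norm (v t x) * \<phi> (t, x) \<partial>evolution g t)"
      using b_int by (subst set_integrable_cong[OF refl refl b_eq])
    have "(LINT t:{0<..<T}|lborel. \<integral>x. deriv (\<lambda>s. \<phi> (s, x)) t + v t x \<bullet> grad (\<lambda>y. \<phi> (t, y)) x \<partial>evolution g t) =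
        (LINT t:{0<..<T}|lborel. ?a t)"
      by (rule set_lebesgue_integral_cong[OF _ allI[OF impI[OF a_eq]]]) simp
    also note eq
    also have "(LINT t:{0<..<T}|lborel. ?b t) =
        (LINT t:{0<..<T}|lborel. \<integral>x. \<epsilon> * norm (v t x) * \<phi> (t, x) \<partial>evolution g t)"
      by (rule set_lebesgue_integral_cong[OF _ allI[OF impI[OF b_eq[symmetric]]]]) simp
    finally show "(LINT t:{0<..<T}|lborel. \<integral>x. deriv (\<lambda>s. \<phi> (s, x)) t + v t x \<bullet> grad (\<lambda>y. \<phi> (t, y)) x \<partial>evolution g t) =
        (LINT t:{0<..<T}|lborel. \<integral>x. \<epsilon> * norm (v t x) * \<phi> (t, x) \<partial>evolution g t)" .
  qed (use int_ev in \<open>simp_all add: transport loss\<close>)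
qed

end

theorem theorem1p13:
  fixes W \<Phi> :: "real ^ 'd \<Rightarrow> real"
    and B\<^sub>1 b\<^sub>2 \<alpha>\<^sub>0 \<alpha> \<epsilon> T :: real
    and \<mu>\<^sub>0 :: "((real ^ 'd) \<times> (real ^ 'd)) measure"
  assumes W: "Ck 2 W" "compact (supp W)" "\<And>q. W (- q) = W q"
    and \<Phi>: "Ck 2 \<Phi>" "\<And>q. q \<noteq> 0 \<Longrightarrow> \<bar>\<Phi> q\<bar> \<le> B\<^sub>1 * norm q powr b\<^sub>2"
    and "\<alpha>\<^sub>0 > 0" "\<epsilon> > 0" "T > 0"
    and \<mu>\<^sub>0: "\<mu>\<^sub>0 \<in> exp_moment_measures \<alpha>\<^sub>0" "emeasure \<mu>\<^sub>0 UNIV = 1"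
    and \<alpha>: "0 \<le> \<alpha>" "\<alpha> < min \<alpha>\<^sub>0 \<epsilon>"
  shows "\<exists>\<mu> :: real \<Rightarrow> ((real ^ 'd) \<times> (real ^ 'd)) measure.
      (\<forall>t\<in>{0..T}. \<mu> t \<in> exp_moment_measures \<alpha>) \<and>
      \<mu> 0 = \<mu>\<^sub>0 \<and>
      deficient_continuity_eq \<epsilon> T (\<lambda>t x. J (grad_Ham W \<Phi> (\<mu> t) x)) \<mu> \<and>
      narrowly_continuous_on {0..T} \<mu> \<and>
      antimono_on {0..T} (\<lambda>t. exp_moment \<alpha> (\<mu> t)) \<and>
      (\<forall>t\<in>{0..T}. exp_moment 0 (\<mu> t) \<le> 1)"
proof -
  have sets: "sets \<mu>\<^sub>0 = sets borel" and moment: "exp_moment \<alpha>\<^sub>0 \<mu>\<^sub>0 < \<infinity>"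
    using \<mu>\<^sub>0 by (auto simp: exp_moment_measures_def)
  obtain C L where CL: "\<And>q. norm (grad W q) \<le> C" "\<And>q r. norm (grad W q - grad W r) \<le> L * norm (q - r)"
    using compact_support_grad[OF W(1,2)] by blast
  \<comment> \<open>\<open>K\<close> is \<open>grad W\<close>, whose constants are global by compact
    support; \<open>\<psi>\<close> is \<open>grad \<Phi>\<close>, Lipschitz on balls by C2
    regularity.\<close>
  interpret damped_flow "grad W" "grad \<Phi>" C L \<epsilon> \<mu>\<^sub>0
  proof
    show "\<exists>B. \<forall>q\<in>cball 0 R. \<forall>r\<in>cball 0 R. norm (grad \<Phi> q - grad \<Phi> r) \<le> B * norm (q - r)" for R
      using Ck2_grad_lipschitz[OF \<Phi>(1), of R] by metis
  qed (use sets CL \<mu>\<^sub>0 \<open>\<epsilon> > 0\<close> in auto)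
  obtain g where g: "force g" and fix_g: "\<And>t. 0 \<le> t \<Longrightarrow> gforce g t = g t"
    using self_consistent_force by blast
  have "exp_moment \<alpha> \<mu>\<^sub>0 \<le> exp_moment \<alpha>\<^sub>0 \<mu>\<^sub>0"
    unfolding exp_moment_def using \<alpha> by (intro nn_integral_mono ennreal_leI) (auto intro!: mult_right_mono)
  then have fin: "exp_moment \<alpha> \<mu>\<^sub>0 < \<infinity>" using moment by (rule order_le_less_trans)
  have mono: "exp_moment \<beta> (evolution g t) \<le> exp_moment \<beta> (evolution g s)"
    if "0 \<le> \<beta>" "\<beta> \<le> \<epsilon>" "0 \<le> s" "s \<le> t" for \<beta> s t
    using that by (rule evolution_exp_moment_antimono[OF g])
  \<comment> \<open>The average of \<open>grad W\<close> over \<open>evolution g t\<close> is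
    \<open>gforce g t\<close>, and self-consistency replaces it by \<open>g t\<close>. This makes
    the Hamiltonian field of the evolving measure the very field \<open>vel g\<close> that
    transports it.\<close>
  have "deficient_continuity_eq \<epsilon> T (\<lambda>t x. J (grad_Ham W \<Phi> (evolution g t) x)) (evolution g)"
    by (rule evolution_deficient_continuity_eq[OF g \<open>T > 0\<close>])
       (simp add: J_grad_Ham_eq[OF finite_evolution[OF g] _ W(1,2) \<Phi>(1)] evolution_gforce[OF g] fix_g vel_def)
  moreover have "evolution g t \<in> exp_moment_measures \<alpha>" if "t \<in> {0..T}" for t
    using mono[of \<alpha> 0 t] fin \<alpha> that
    by (auto simp: exp_moment_measures_def evolution_0[OF g] intro: order_le_less_trans)
  moreover have "antimono_on {0..T} (\<lambda>t. exp_moment \<alpha> (evolution g t))"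
    using \<alpha> by (intro monotone_onI mono) auto
  moreover have "exp_moment 0 (evolution g t) \<le> 1" if "t \<in> {0..T}" for t
    using mono[of 0 0 t] \<mu>\<^sub>0(2) \<open>\<epsilon> > 0\<close> that by (simp add: evolution_0[OF g] exp_moment_def)
  ultimately show ?thesis
    using evolution_narrowly_continuous[OF g] evolution_0[OF g] by blast
qed

end
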